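(* Let $f:2^X\to\mathbb{R}_{\ge0}$ be non-negative submodular, the constraint an arbitrary $p$-matchoid, and $\varepsilon>0$. Define $\gamma_1=4p$ and $\gamma_i=\frac{4p\gamma_{i-1}(\gamma_{i-1}-1)}{(\gamma_{i-1}-1+p)^2}$ for $i>1$. Run MultipassRandomizedLocalSearch$(\alpha,\beta_1,\dots,\beta_d,m)$ with buffer size $m=4dk/\varepsilon^2$, $\alpha=\varepsilon f(\mathit{OPT})/(2k)$, $\beta_1=1$ and $\beta_i=\frac{\gamma_{i-1}-1-p}{\gamma_{i-1}-1+p}$ for $i>1$. Then for every $1\le i\le d$, \[ (1-\varepsilon)f(\mathit{OPT})\le\Bigl(p+1+\frac{4p}{i}\Bigr)\mathbb{E}[f(S_i)]+\bar\gamma_{\mathrm{off}}\mathbb{E}[f(S'_i)]. \] In particular, with $d=4p/\varepsilon$ passes, the output $\bar S$ satisfies $(1-\varepsilon)f(\mathit{OPT})\le(p+1+\bar\gamma_{\mathrm{off}}+\varepsilon)\mathbb{E}[f(\bar S)]$. Moreover, under a single matroid constraint, the algorithm with $\alpha=\varepsilon f(\mathit{OPT})/(2k)$, $\beta_i=1/i$ and $d=2/\varepsilon$ passes (and $m=4dk/\varepsilon^2$) outputs $\bar S$ with $(1-\varepsilon)f(\mathit{OPT})\le(2+\bar\gamma_{\mathrm{off}}+\varepsilon)\mathbb{E}[f(\bar S)]$, where $\bar\gamma_{\mathrm{off}}$ is the approximation ratio of the offline algorithm used for maximizing $f$ under a matroid constraint.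
   Context: $X$ is a finite ground set and $f:2^X\to\mathbb{R}_{\ge0}$ is submodular (not necessarily monotone). For $e\in X$, $A\subseteq X$ write $f(e\mid A)=f(A\cup\{e\})-f(A)$. A $p$-matchoid on $X$ is a collection of matroids $\mathcal{M}_\ell=(X_\ell,\mathcal{I}_\ell)$, $X_\ell\subseteq X$, with every element of $X$ in at most $p$ of the sets $X_\ell$; $S$ is feasible ($S\in\mathcal{I}$) iff $S\cap X_\ell\in\mathcal{I}_\ell$ for all $\ell$ (a single matroid is the case $p=1$). The rank $k$ is the maximum size of a feasible set; $\mathit{OPT}$ is a feasible set maximizing $f$. Elements of $X$ arrive one at a time in a stream; each pass receives all of $X$. Offline is an algorithm with approximation factor $\bar\gamma_{\mathrm{off}}$: given $B\subseteq X$ it returns a feasible $S'\subseteq B$ with $\max_{T\subseteq B,T\in\mathcal{I}}f(T)\le\bar\gamma_{\mathrm{off}}\mathbb{E}[f(S')]$. Incremental values: for a total order $\prec$ on $X$, $\nu(e,T)=f(e\mid\{t\in T:t\prec e\})$; here $\prec$ is the order in which elements are inserted into the current solution $S$, elements of the initial solution coming first in their previous order. Exchange$(x,S)$: start with $C_x=\emptyset$; for each $\mathcal{M}_\ell$ with $x\in X_\ell$, let $S_\ell=S\cap X_\ell$; if $S_\ell\cup\{x\}\notin\mathcal{I}_\ell$, let $T_\ell=\{y\in S_\ell:(S_\ell\setminus\{y\})\cup\{x\}\in\mathcal{I}_\ell\}$ and add to $C_x$ an element of $T_\ell$ minimizing $\nu(\cdot,S)$. Return $C_x$. RandomizedLocalSearch$(S_{\mathrm{init}},\alpha,\beta,m)$: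 $S\leftarrow S_{\mathrm{init}}$, $B\leftarrow\emptyset$. For each arriving $x$: with $C_x=$ Exchange$(x,S)$, if $f(x\mid S)\ge\alpha+(1+\beta)\sum_{e\in C_x}\nu(e,S)$ add $x$ to $B$. Whenever $|B|=m$: choose $x$ uniformly at random from $B$, compute $C_x=$ Exchange$(x,S)$, remove $x$ from $B$, set $S\leftarrow(S\setminus C_x)\cup\{x\}$; then for each $x'\in B$ recompute $C_{x'}=$ Exchange$(x',S)$ and remove $x'$ from $B$ if $f(x'\mid S)<\alpha+(1+\beta)\sum_{e\in C_{x'}}\nu(e,S)$. At the end of the stream set $S'=$ Offline$(B)$ and return $(S,S')$. MultipassRandomizedLocalSearch$(\alpha,\beta_1,\dots,\beta_d,m)$: $S_0=S'_0=\emptyset$; for $i=1,\dots,d$, let $(\tilde S,S')$ be the output of RandomizedLocalSearch$(S_{i-1},\alpha,\beta_i,m)$ on a new pass, set $S_i=\tilde S$ and $S'_i$ the one of $S'_{i-1},S'$ with larger $f$-value. Return $\bar S=\bar S_d$, the one of $S_d,S'_d$ with larger $f$-value. *)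

theory Defs
  imports "HOL-Probability.Probability"
begin

definition matroid :: "'a set \<Rightarrow> 'a set set \<Rightarrow> bool" where
  "matroid E \<I> \<longleftrightarrow> finite E \<and> \<I> \<subseteq> Pow E \<and> {} \<in> \<I> \<and>
     (\<forall>A B. B \<in> \<I> \<longrightarrow> A \<subseteq> B \<longrightarrow> A \<in> \<I>) \<and>
     (\<forall>A\<in>\<I>. \<forall>B\<in>\<I>. card A < card B \<longrightarrow> (\<exists>b\<in>B - A. insert b A \<in> \<I>))"

text \<open>A collection of matroids is a family indexed by a finite set \<open>L\<close>; its member \<open>l\<close> has the ground
  set \<open>E l\<close> and the independent sets \<open>\<I> l\<close>.\<close>

definition matchoid :: "nat \<Rightarrow> 'a set \<Rightarrow> 'i set \<Rightarrow> ('i \<Rightarrow> 'a set) \<Rightarrow> ('i \<Rightarrow> 'a set set) \<Rightarrow> bool" where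
  "matchoid p X L E \<I> \<longleftrightarrow> finite X \<and> finite L \<and>
     (\<forall>l\<in>L. E l \<subseteq> X \<and> matroid (E l) (\<I> l)) \<and>
     (\<forall>x\<in>X. card {l\<in>L. x \<in> E l} \<le> p)"

definition feasible :: "'a set \<Rightarrow> 'i set \<Rightarrow> ('i \<Rightarrow> 'a set) \<Rightarrow> ('i \<Rightarrow> 'a set set) \<Rightarrow> 'a set \<Rightarrow> bool" where
  "feasible X L E \<I> S \<longleftrightarrow> S \<subseteq> X \<and> (\<forall>l\<in>L. S \<inter> E l \<in> \<I> l)"

definition matchoid_rank :: "'a set \<Rightarrow> 'i set \<Rightarrow> ('i \<Rightarrow> 'a set) \<Rightarrow> ('i \<Rightarrow> 'a set set) \<Rightarrow> nat" where
  "matchoid_rank X L E \<I> = Max (card ` {S. feasible X L E \<I> S})"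

definition submodular_on :: "'a set \<Rightarrow> ('a set \<Rightarrow> real) \<Rightarrow> bool" where
  "submodular_on X f \<longleftrightarrow>
     (\<forall>A B. A \<subseteq> X \<longrightarrow> B \<subseteq> X \<longrightarrow> f (A \<union> B) + f (A \<inter> B) \<le> f A + f B)"

definition is_opt ::
  "('a set \<Rightarrow> real) \<Rightarrow> 'a set \<Rightarrow> 'i set \<Rightarrow> ('i \<Rightarrow> 'a set) \<Rightarrow> ('i \<Rightarrow> 'a set set) \<Rightarrow> 'a set \<Rightarrow> bool" where
  "is_opt f X L E \<I> S \<longleftrightarrow> feasible X L E \<I> S \<and> (\<forall>T. feasible X L E \<I> T \<longrightarrow> f T \<le> f S)"

definition offline_approx ::
  "('a set \<Rightarrow> real) \<Rightarrow> 'a set \<Rightarrow> 'i set \<Rightarrow> ('i \<Rightarrow> 'a set) \<Rightarrow> ('i \<Rightarrow> 'a set set) \<Rightarrow>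
   ('a set \<Rightarrow> 'a set pmf) \<Rightarrow> real \<Rightarrow> bool" where
  "offline_approx f X L E \<I> offline \<gamma> \<longleftrightarrow>
     (\<forall>B. B \<subseteq> X \<longrightarrow>
        set_pmf (offline B) \<subseteq> {S. S \<subseteq> B \<and> feasible X L E \<I> S} \<and>
        Max (f ` {T. T \<subseteq> B \<and> feasible X L E \<I> T}) \<le> \<gamma> * measure_pmf.expectation (offline B) f)"

definition marginal :: "('a set \<Rightarrow> real) \<Rightarrow> 'a \<Rightarrow> 'a set \<Rightarrow> real" where
  "marginal f e A = f (A \<union> {e}) - f A"

text \<open>The current solution is a distinct list, ordered by insertion time (oldest element first), so
  that \<open>takeWhile (\<lambda>t. t \<noteq> e) S\<close> lists the elements of the solution that precede \<open>e\<close>.\<close>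

definition incr_value :: "('a set \<Rightarrow> real) \<Rightarrow> 'a \<Rightarrow> 'a list \<Rightarrow> real" where
  "incr_value f e S = marginal f e (set (takeWhile (\<lambda>t. t \<noteq> e) S))"

text \<open>\<open>tie\<close> is an arbitrary rule for choosing among several minimizers; it may look at the
  matroid, the arriving element and the current solution.\<close>

definition tie_rule :: "('i \<Rightarrow> 'a \<Rightarrow> 'a list \<Rightarrow> 'a set \<Rightarrow> 'a) \<Rightarrow> bool" where
  "tie_rule tie \<longleftrightarrow> (\<forall>l x S T. T \<noteq> {} \<longrightarrow> tie l x S T \<in> T)"

context
  fixes f :: "'a set \<Rightarrow> real"
    and X :: "'a set" and L :: "'i set" and E :: "'i \<Rightarrow> 'a set" and \<I> :: "'i \<Rightarrow> 'a set set"
    and tie :: "'i \<Rightarrow> 'a \<Rightarrow> 'a list \<Rightarrow> 'a set \<Rightarrow> 'a"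
    and offline :: "'a set \<Rightarrow> 'a set pmf"
begin

definition swap_candidates :: "'i \<Rightarrow> 'a \<Rightarrow> 'a list \<Rightarrow> 'a set" where
  "swap_candidates l x S =
     (let S\<^sub>l = set S \<inter> E l in {y\<in>S\<^sub>l. (S\<^sub>l - {y}) \<union> {x} \<in> \<I> l})"

definition exchange :: "'a \<Rightarrow> 'a list \<Rightarrow> 'a set" where
  "exchange x S =
     (\<lambda>l. let T = swap_candidates l x S in
            tie l x S {y\<in>T. \<forall>z\<in>T. incr_value f y S \<le> incr_value f z S})
     ` {l\<in>L. x \<in> E l \<and> (set S \<inter> E l) \<union> {x} \<notin> \<I> l}"

text \<open>If \<open>{x}\<close> is infeasible (\<open>x\<close> is a loop of one of the matroids), then the set of swap candidates
  is empty for that matroid and the exchange is not defined. Such elements are discarded. For all other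
  elements the first conjunct is true and only the threshold matters.\<close>

definition qualifies :: "real \<Rightarrow> real \<Rightarrow> 'a list \<Rightarrow> 'a \<Rightarrow> bool" where
  "qualifies \<alpha> \<beta> S x \<longleftrightarrow> feasible X L E \<I> {x} \<and>
     marginal f x (set S) \<ge> \<alpha> + (1 + \<beta>) * (\<Sum>e\<in>exchange x S. incr_value f e S)"

text \<open>Emptying step for a full buffer \<open>B\<close>. Excluding \<open>x\<close> in the filter only keeps the list distinct.\<close>

definition buffer_step :: "real \<Rightarrow> real \<Rightarrow> 'a list \<times> 'a set \<Rightarrow> ('a list \<times> 'a set) pmf" where
  "buffer_step \<alpha> \<beta> = (\<lambda>(S, B). do {
     x \<leftarrow> pmf_of_set B;
     let S' = filter (\<lambda>y. y \<notin> exchange x S \<and> y \<noteq> x) S @ [x];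
     return_pmf (S', {x' \<in> B - {x}. qualifies \<alpha> \<beta> S' x'})
   })"

text \<open>The buffer can only reach size \<open>m\<close> when an element is added to it, and an emptying step
  leaves fewer than \<open>m\<close> elements, so one test per added element suffices.\<close>

definition arrival :: "real \<Rightarrow> real \<Rightarrow> nat \<Rightarrow> 'a \<Rightarrow> 'a list \<times> 'a set \<Rightarrow> ('a list \<times> 'a set) pmf" where
  "arrival \<alpha> \<beta> m x = (\<lambda>(S, B).
     if qualifies \<alpha> \<beta> S x
     then (if card (insert x B) = m then buffer_step \<alpha> \<beta> (S, insert x B)
           else return_pmf (S, insert x B))
     else return_pmf (S, B))"

fun process_stream ::
  "real \<Rightarrow> real \<Rightarrow> nat \<Rightarrow> 'a list \<Rightarrow> 'a list \<times> 'a set \<Rightarrow> ('a list \<times> 'a set) pmf" where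
  "process_stream \<alpha> \<beta> m [] s = return_pmf s"
| "process_stream \<alpha> \<beta> m (x # xs) s = arrival \<alpha> \<beta> m x s \<bind> process_stream \<alpha> \<beta> m xs"

definition rand_local_search ::
  "real \<Rightarrow> real \<Rightarrow> nat \<Rightarrow> 'a list \<Rightarrow> 'a list \<Rightarrow> ('a list \<times> 'a set) pmf" where
  "rand_local_search \<alpha> \<beta> m xs S\<^sub>i\<^sub>n\<^sub>i\<^sub>t = do {
     (S, B) \<leftarrow> process_stream \<alpha> \<beta> m xs (S\<^sub>i\<^sub>n\<^sub>i\<^sub>t, {});
     S' \<leftarrow> offline B;
     return_pmf (S, S')
   }"

text \<open>\<open>multipass \<alpha> \<beta> m \<sigma> i\<close> is the joint distribution of the two solutions maintained by the
  algorithm after pass \<open>i\<close>, where \<open>\<sigma> i\<close> is the arrival order in pass \<open>i\<close> (counted from 1).\<close>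

fun multipass ::
  "real \<Rightarrow> (nat \<Rightarrow> real) \<Rightarrow> nat \<Rightarrow> (nat \<Rightarrow> 'a list) \<Rightarrow> nat \<Rightarrow> ('a list \<times> 'a set) pmf" where
  "multipass \<alpha> \<beta> m \<sigma> 0 = return_pmf ([], {})"
| "multipass \<alpha> \<beta> m \<sigma> (Suc i) = do {
     (S, S') \<leftarrow> multipass \<alpha> \<beta> m \<sigma> i;
     (T, T') \<leftarrow> rand_local_search \<alpha> (\<beta> (Suc i)) m (\<sigma> (Suc i)) S;
     return_pmf (T, if f S' \<ge> f T' then S' else T')
   }"

definition multipass_output ::
  "real \<Rightarrow> (nat \<Rightarrow> real) \<Rightarrow> nat \<Rightarrow> (nat \<Rightarrow> 'a list) \<Rightarrow> nat \<Rightarrow> 'a set pmf" where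
  "multipass_output \<alpha> \<beta> m \<sigma> d =
     map_pmf (\<lambda>(S, S'). if f (set S) \<ge> f S' then set S else S') (multipass \<alpha> \<beta> m \<sigma> d)"

end

text \<open>The sequences start at index 1; the value of \<open>gamma_seq p 0\<close> is unspecified and not used.\<close>

fun gamma_seq :: "nat \<Rightarrow> nat \<Rightarrow> real" where
  "gamma_seq p (Suc 0) = 4 * real p"
| "gamma_seq p (Suc (Suc i)) =
     (let g = gamma_seq p (Suc i) in 4 * real p * g * (g - 1) / (g - 1 + real p)\<^sup>2)"

definition beta_seq :: "nat \<Rightarrow> nat \<Rightarrow> real" where
  "beta_seq p i =
     (if i \<le> 1 then 1
      else (gamma_seq p (i - 1) - 1 - real p) / (gamma_seq p (i - 1) - 1 + real p))"

text \<open>The buffer size \<open>4dk/\<epsilon>\<^sup>2\<close>, rounded up to an integer.\<close>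

definition buffer_size :: "nat \<Rightarrow> nat \<Rightarrow> real \<Rightarrow> nat" where
  "buffer_size d k \<epsilon> = nat \<lceil>4 * real d * real k / \<epsilon>\<^sup>2\<rceil>"

end

theory Submission
  imports Defs
begin

text \<open>Each exchange raises \<open>f S\<close> by at least \<open>\<alpha>\<close>, so at most \<open>f OPT / \<alpha> = 2 k / \<epsilon>\<close> exchanges happen over all
  passes, and each of them picks a uniformly random element of a set of \<open>m\<close> elements. Hence every element
  enters the solution with probability at most \<open>\<epsilon> / (2 d)\<close>, and adding a random set with such small
  marginals to \<open>OPT\<close> costs only that fraction of \<open>f OPT\<close>. Within a pass, this is tracked by the
  submartingale \<open>(1 - (f OPT - f S) / (\<alpha> m)) * f (OPT \<union> A)\<close>, where \<open>A\<close> collects all elements that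
  were in the solution.

  Conversely \<open>f (OPT \<union> A)\<close> is bounded by charging the rejected elements of \<open>OPT\<close> to incremental values. In
  every matroid and for every threshold \<open>\<theta>\<close>, the span of the solution elements of value at least \<open>\<theta>\<close>,
  together with the elements discarded on behalf of other matroids at value at least \<open>\<theta>\<close>, only grows with
  time, and it contains every rejected element whose exchange partner had value at least \<open>\<theta>\<close>. Comparing
  cardinalities for each \<open>\<theta>\<close> bounds the total charge in that matroid.
  This gives, for pass \<open>i\<close> with \<open>\<beta> = \<beta>\<^sub>i\<close>,
  \<open>(1 - \<epsilon>) f OPT \<le> p (1 + \<beta>)\<^sup>2 / \<beta> E f(S\<^sub>i) - (p / \<beta> + p - 1) E f(S\<^sub>i\<^sub>-\<^sub>1) + \<gamma>\<^sub>o\<^sub>f\<^sub>f E f(S'\<^sub>i)\<close>,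
  and eliminating \<open>S\<^sub>i\<^sub>-\<^sub>1\<close> with the bound of the previous pass yields the recurrence for \<open>\<gamma>\<^sub>i\<close>.\<close>

section \<open>Matroid spans\<close>

lemma matroidD:
  assumes "matroid E \<I>"
  shows matroid_finite: "finite E"
    and matroid_subset: "\<And>A. A \<in> \<I> \<Longrightarrow> A \<subseteq> E"
    and matroid_empty: "{} \<in> \<I>"
    and matroid_mono: "\<And>A B. B \<in> \<I> \<Longrightarrow> A \<subseteq> B \<Longrightarrow> A \<in> \<I>"
    and matroid_augment: "\<And>A B. A \<in> \<I> \<Longrightarrow> B \<in> \<I> \<Longrightarrow> card A < card B \<Longrightarrow> \<exists>b\<in>B - A. insert b A \<in> \<I>"
  using assms unfolding matroid_def by (auto simp: subset_iff)

text \<open>Augmentation by elements of \<open>B\<close> is iterated; each round adds one new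
  element, so every size up to \<open>card B\<close> is reached.\<close>

lemma matroid_extend:
  assumes "matroid E \<I>" "A \<in> \<I>" "B \<in> \<I>" "card A \<le> card B"
  shows "\<exists>C\<in>\<I>. A \<subseteq> C \<and> C \<subseteq> A \<union> B \<and> card C = card B"
proof -
  have "\<exists>C\<in>\<I>. A \<subseteq> C \<and> C \<subseteq> A \<union> B \<and> card C = card A + n" if "card A + n \<le> card B" for n
    using that
  proof (induction n)
    case 0
    then show ?case using assms(2) by auto
  next
    case (Suc n)
    then obtain C where C: "C \<in> \<I>" "A \<subseteq> C" "C \<subseteq> A \<union> B" "card C = card A + n" by auto
    then obtain b where b: "b \<in> B - C" "insert b C \<in> \<I>"
      using matroid_augment[OF assms(1) C(1) assms(3)] Suc.prems by auto
    have "finite C" using matroid_subset[OF assms(1) C(1)] matroid_finite[OF assms(1)]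
      by (rule finite_subset)
    then show ?case using b C by (intro bexI[of _ "insert b C"]) auto
  qed
  from this[of "card B - card A"] show ?thesis using assms(4) by auto
qed

text \<open>The closure of \<open>V\<close>, written without a rank function: an element outside
  \<open>V\<close> is spanned iff it makes some independent subset of \<open>V\<close> dependent.
  Loops are covered by the empty subset.\<close>

definition mspan :: "'a set \<Rightarrow> 'a set set \<Rightarrow> 'a set \<Rightarrow> 'a set" where
  "mspan E \<I> V = {e \<in> E. e \<in> V \<or> (\<exists>J\<in>\<I>. J \<subseteq> V \<and> insert e J \<notin> \<I>)}"

lemma mspan_superset: "V \<subseteq> E \<Longrightarrow> V \<subseteq> mspan E \<I> V"
  by (auto simp: mspan_def)

text \<open>\<open>I\<close> is a largest independent subset of \<open>V\<close>. If a spanned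
  \<open>e\<close> extended \<open>I\<close>, the set \<open>J\<close> witnessing the span could be
  enlarged from \<open>insert e I\<close> to size \<open>card I + 1\<close>. The result avoids
  \<open>e\<close>, because \<open>J\<close> with \<open>e\<close> is dependent, so it lies in
  \<open>V\<close>, against maximality.\<close>

lemma mspan_basis:
  assumes M: "matroid E \<I>"
  obtains I where "I \<in> \<I>" "I \<subseteq> V" "\<And>e. e \<in> mspan E \<I> V \<Longrightarrow> e \<in> I \<or> insert e I \<notin> \<I>"
proof -
  let ?\<J> = "{J \<in> \<I>. J \<subseteq> V}"
  have sub: "?\<J> \<subseteq> Pow E" using matroid_subset[OF M] by auto
  have fin: "finite ?\<J>" using finite_subset[OF sub] matroid_finite[OF M] by simp
  have "{} \<in> ?\<J>" using matroid_empty[OF M] by simp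
  then have "Max (card ` ?\<J>) \<in> card ` ?\<J>" using fin by (intro Max_in) auto
  then obtain I where I: "I \<in> \<I>" "I \<subseteq> V" and cI: "card I = Max (card ` ?\<J>)" by auto
  have max: "card J \<le> card I" if "J \<in> \<I>" "J \<subseteq> V" for J
    unfolding cI using that fin by (intro Max_ge) auto
  have finI: "finite I" using matroid_subset[OF M I(1)] matroid_finite[OF M] by (rule finite_subset)
  have "e \<in> I \<or> insert e I \<notin> \<I>" if e: "e \<in> mspan E \<I> V" for e
  proof (rule ccontr)
    assume "\<not> ?thesis"
    then have eI: "e \<notin> I" "insert e I \<in> \<I>" by auto
    have "e \<notin> V"
      using max[OF eI(2)] eI(1) I(2) finI by auto
    then obtain J where J: "J \<in> \<I>" "J \<subseteq> V" "insert e J \<notin> \<I>"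
      using e by (auto simp: mspan_def)
    have "card J \<le> card (insert e I)" using max[OF J(1,2)] eI(1) finI by simp
    then obtain C where C: "C \<in> \<I>" "J \<subseteq> C" "C \<subseteq> J \<union> insert e I" "card C = card (insert e I)"
      using matroid_extend[OF M J(1) eI(2)] by blast
    have "e \<notin> C" using J(3) matroid_mono[OF M C(1), of "insert e J"] C(2) by auto
    then have "C \<subseteq> V" using C(3) J(2) I(2) by auto
    then show False using max[OF C(1)] C(4) eI(1) finI by simp
  qed
  then show ?thesis using that I by blast
qed

text \<open>A larger \<open>J\<close> would augment the basis \<open>I\<close> of \<open>V\<close>
  by a spanned element, which \<open>mspan_basis\<close> rules out.\<close>

lemma card_independent_le:
  assumes M: "matroid E \<I>" and "J \<in> \<I>" "J \<subseteq> mspan E \<I> V" "finite V"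
  shows "card J \<le> card V"
proof -
  obtain I where I: "I \<in> \<I>" "I \<subseteq> V" "\<And>e. e \<in> mspan E \<I> V \<Longrightarrow> e \<in> I \<or> insert e I \<notin> \<I>"
    using mspan_basis[OF M] by metis
  have "card J \<le> card I"
  proof (rule ccontr)
    assume "\<not> ?thesis"
    then obtain b where "b \<in> J - I" "insert b I \<in> \<I>"
      using matroid_augment[OF M I(1) assms(2)] by auto
    then show False using I(3) assms(3) by auto
  qed
  then show ?thesis using card_mono[OF assms(4) I(2)] by simp
qed

text \<open>Idempotence of the closure, used to carry charges from one exchange to the next. The
  argument of \<open>mspan_basis\<close> is repeated inside the span of \<open>W\<close>, where a
  basis \<open>I\<close> of \<open>W\<close> is still a largest independent set.\<close>

lemma mspan_trans:
  assumes M: "matroid E \<I>" and "V \<subseteq> mspan E \<I> W" "e \<in> mspan E \<I> V"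
  shows "e \<in> mspan E \<I> W"
proof (cases "e \<in> V")
  case True
  then show ?thesis using assms(2) by auto
next
  case False
  then obtain J where J: "J \<in> \<I>" "J \<subseteq> V" "insert e J \<notin> \<I>" and e: "e \<in> E"
    using assms(3) by (auto simp: mspan_def)
  obtain I where I: "I \<in> \<I>" "I \<subseteq> W" "\<And>x. x \<in> mspan E \<I> W \<Longrightarrow> x \<in> I \<or> insert x I \<notin> \<I>"
    using mspan_basis[OF M] by metis
  have finI: "finite I" using matroid_subset[OF M I(1)] matroid_finite[OF M] by (rule finite_subset)
  have bound: "card K \<le> card I" if K: "K \<in> \<I>" "K \<subseteq> mspan E \<I> W" for K
  proof (rule ccontr)
    assume "\<not> ?thesis"
    then obtain b where "b \<in> K - I" "insert b I \<in> \<I>"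
      using matroid_augment[OF M I(1) K(1)] by auto
    then show False using I(3) K(2) by auto
  qed
  have IW: "I \<subseteq> mspan E \<I> W" using I(1,2) matroid_subset[OF M I(1)] by (auto simp: mspan_def)
  have "insert e I \<notin> \<I> \<or> e \<in> I"
  proof (rule ccontr)
    assume "\<not> ?thesis"
    then have eI: "insert e I \<in> \<I>" "e \<notin> I" by auto
    have "card J \<le> card I" using bound[OF J(1)] J(2) assms(2) by blast
    then have "card J \<le> card (insert e I)" using eI finI by simp
    then obtain C where C: "C \<in> \<I>" "J \<subseteq> C" "C \<subseteq> J \<union> insert e I" "card C = card (insert e I)"
      using matroid_extend[OF M J(1) eI(1)] by blast
    have "e \<notin> C" using J(3) matroid_mono[OF M C(1), of "insert e J"] C(2) by auto
    then have "C \<subseteq> mspan E \<I> W" using C(3) J(2) IW assms(2) by auto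
    then show False using bound[OF C(1)] C(4) eI finI by simp
  qed
  then show ?thesis using I(1,2) e by (auto simp: mspan_def)
qed

text \<open>The set is the fundamental circuit of \<open>x\<close> in \<open>I\<close>. Were it
  independent, extending it from \<open>I\<close> to \<open>card I\<close> elements would omit
  exactly one element \<open>y\<close> of \<open>insert x I\<close>. Then
  \<open>insert x (I - {y})\<close> is independent, so \<open>y\<close> is in the circuit and cannot
  have been omitted.\<close>

lemma swap_circuit_dependent:
  assumes M: "matroid E \<I>" and I: "I \<in> \<I>" "insert x I \<notin> \<I>"
  shows "insert x {y \<in> I. insert x (I - {y}) \<in> \<I>} \<notin> \<I>" (is "insert x ?T \<notin> \<I>")
proof
  assume T: "insert x ?T \<in> \<I>"
  have x: "x \<notin> I" using I by (metis insert_absorb)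
  have finI: "finite I" using matroid_subset[OF M I(1)] matroid_finite[OF M] by (rule finite_subset)
  have "?T \<noteq> I" using T I(2) by auto
  then have "card ?T < card I" using finI by (intro psubset_card_mono) auto
  then have "card (insert x ?T) \<le> card I" using x finI by auto
  then obtain C where C: "C \<in> \<I>" "insert x ?T \<subseteq> C" "C \<subseteq> insert x ?T \<union> I" "card C = card I"
    using matroid_extend[OF M T I(1)] by blast
  have CI: "C \<subseteq> insert x I" using C(3) by auto
  have "card (insert x I - C) = 1"
    using CI C(4) x finI card_Diff_subset[of C "insert x I"] finite_subset[OF CI] by auto
  then obtain y where y: "insert x I - C = {y}" by (auto simp: card_1_singleton_iff)
  then have yI: "y \<in> I" "y \<notin> C" using C(2) by auto
  have "insert x (I - {y}) \<subseteq> C" using y C(2) by auto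
  then have "insert x (I - {y}) \<in> \<I>" using matroid_mono[OF M C(1)] by blast
  then show False using yI C(2) by auto
qed

text \<open>A discrete layer-cake comparison: a largest term of \<open>a\<close> is matched with a
  term of \<open>b\<close> that is at least as large, both are removed, and the induction
  continues.\<close>

lemma sum_le_sum_if_card_threshold_le:
  fixes a :: "'a \<Rightarrow> real" and b :: "'b \<Rightarrow> real"
  assumes "finite I" "finite J" "\<And>j. j \<in> J \<Longrightarrow> 0 \<le> b j"
    and "\<And>\<theta>. \<theta> > 0 \<Longrightarrow> card {i\<in>I. \<theta> \<le> a i} \<le> card {j\<in>J. \<theta> \<le> b j}"
  shows "sum a I \<le> sum b J"
  using assms
proof (induction "card I" arbitrary: I J)
  case 0
  then show ?case by (simp add: sum_nonneg)
next
  case (Suc n)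
  then have ne: "I \<noteq> {}" by auto
  define t where "t = Max (a ` I)"
  have "t \<in> a ` I" unfolding t_def using Suc.prems(1) ne by (intro Max_in) auto
  then obtain i where i: "i \<in> I" "a i = t" by auto
  have le: "a k \<le> t" if "k \<in> I" for k unfolding t_def using that Suc.prems(1) by simp
  show ?case
  proof (cases "t \<le> 0")
    case True
    then have "sum a I \<le> 0" using le by (intro sum_nonpos) force
    also have "\<dots> \<le> sum b J" using Suc.prems by (intro sum_nonneg) auto
    finally show ?thesis .
  next
    case False
    have "i \<in> {i\<in>I. t \<le> a i}" using i by auto
    then have "card {i\<in>I. t \<le> a i} > 0" using Suc.prems(1) by (auto simp: card_gt_0_iff)
    then have "card {j\<in>J. t \<le> b j} > 0" using Suc.prems(4)[of t] False by linarith
    then obtain j where j: "j \<in> J" "t \<le> b j" by (auto simp: card_gt_0_iff)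
    have "sum a (I - {i}) \<le> sum b (J - {j})"
    proof (rule Suc.hyps(1))
      show "n = card (I - {i})" using Suc.hyps(2) i(1) Suc.prems(1) by simp
    next
      fix \<theta> :: real assume \<theta>: "\<theta> > 0"
      show "card {k \<in> I - {i}. \<theta> \<le> a k} \<le> card {k \<in> J - {j}. \<theta> \<le> b k}"
      \<comment> \<open>Up to \<open>t\<close> both counts drop by exactly one; above
        \<open>t\<close> the left count is zero.\<close>
      proof (cases "\<theta> \<le> t")
        case True
        have 1: "{k \<in> I - {i}. \<theta> \<le> a k} = {k \<in> I. \<theta> \<le> a k} - {i}" by auto
        have 2: "{k \<in> J - {j}. \<theta> \<le> b k} = {k \<in> J. \<theta> \<le> b k} - {j}" by auto
        have "i \<in> {k \<in> I. \<theta> \<le> a k}" "j \<in> {k \<in> J. \<theta> \<le> b k}" using True i j by auto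
        then show ?thesis unfolding 1 2 using Suc.prems(1,2) Suc.prems(4)[OF \<theta>] by simp
      next
        case False
        then have none: "{k \<in> I - {i}. \<theta> \<le> a k} = {}" using le by force
        show ?thesis unfolding none by simp
      qed
    qed (use Suc.prems in auto)
    then show ?thesis
      using i j sum.remove[OF Suc.prems(1) i(1), of a] sum.remove[OF Suc.prems(2) j(1), of b] by simp
  qed
qed

section \<open>Submodular functions and incremental values\<close>

text \<open>Diminishing returns. The condition \<open>x \<notin> B\<close> matters because
  \<open>f\<close> need not be monotone: for \<open>x\<close> in \<open>B\<close> the left side
  would be 0, while the right side may be negative.\<close>

lemma marginal_antimono:
  assumes "submodular_on X f" "A \<subseteq> B" "insert x B \<subseteq> X" "x \<notin> B"
  shows "marginal f x B \<le> marginal f x A"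
proof -
  have "f ((A \<union> {x}) \<union> B) + f ((A \<union> {x}) \<inter> B) \<le> f (A \<union> {x}) + f B"
    using assms(1)[unfolded submodular_on_def, rule_format, of "A \<union> {x}" B] assms(2,3) by auto
  moreover have "(A \<union> {x}) \<union> B = B \<union> {x}" "(A \<union> {x}) \<inter> B = A" using assms by auto
  ultimately show ?thesis by (simp add: marginal_def)
qed

lemma submodular_union_le:
  assumes "submodular_on X f" "finite R" "A \<union> R \<subseteq> X" "A \<inter> R = {}"
  shows "f (A \<union> R) \<le> f A + (\<Sum>e\<in>R. marginal f e A)"
  using assms(2-)
proof (induction R)
  case (insert e R)
  have "marginal f e (A \<union> R) \<le> marginal f e A"
    using insert by (intro marginal_antimono[OF assms(1)]) auto
  moreover have "f (A \<union> insert e R) = f (A \<union> R) + marginal f e (A \<union> R)"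
    by (simp add: marginal_def)
  ultimately show ?case using insert by auto
qed simp

lemma incr_value_append1: "e \<in> set S \<Longrightarrow> incr_value f e (S @ T) = incr_value f e S"
  unfolding incr_value_def by (subst takeWhile_append1[of e]) auto

lemma incr_value_append2: "e \<notin> set S \<Longrightarrow> incr_value f e (S @ [e]) = marginal f e (set S)"
  unfolding incr_value_def by (subst takeWhile_append2) auto

lemma sum_incr_value:
  assumes "distinct S"
  shows "(\<Sum>e\<in>set S. incr_value f e S) = f (set S) - f {}"
  using assms
proof (induction S rule: rev_induct)
  case (snoc y S)
  then have y: "y \<notin> set S" by simp
  have "(\<Sum>e\<in>set S. incr_value f e (S @ [y])) = (\<Sum>e\<in>set S. incr_value f e S)"
    by (intro sum.cong) (auto simp: incr_value_append1)
  then show ?case using snoc y by (simp add: incr_value_append2 marginal_def)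
qed simp

text \<open>Along the list, a removed element costs exactly its incremental value, and a kept one
  contributes at least as much as before, since it has fewer predecessors.\<close>

lemma removal_value_ge:
  assumes "submodular_on X f" "distinct S" "set S \<subseteq> X"
  shows "f (set S) - (\<Sum>c\<in>C \<inter> set S. incr_value f c S) \<le> f (set S - C)"
  using assms(2,3)
proof (induction S rule: rev_induct)
  case (snoc y S)
  then have y: "y \<notin> set S" by simp
  have *: "(\<Sum>c\<in>C \<inter> set S. incr_value f c (S @ [y])) = (\<Sum>c\<in>C \<inter> set S. incr_value f c S)"
    by (intro sum.cong) (auto simp: incr_value_append1)
  have IH: "f (set S) - (\<Sum>c\<in>C \<inter> set S. incr_value f c S) \<le> f (set S - C)"
    using snoc by simp
  have fy: "f (set (S @ [y])) = f (set S) + marginal f y (set S)" by (simp add: marginal_def)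
  show ?case
  proof (cases "y \<in> C")
    case True
    then have "C \<inter> set (S @ [y]) = insert y (C \<inter> set S)" "set (S @ [y]) - C = set S - C" by auto
    then show ?thesis using IH * fy y by (simp add: incr_value_append2)
  next
    case False
    then have "C \<inter> set (S @ [y]) = C \<inter> set S" by auto
    moreover have "f (set (S @ [y]) - C) = f (set S - C) + marginal f y (set S - C)"
    proof -
      have "set (S @ [y]) - C = (set S - C) \<union> {y}" using False by auto
      then show ?thesis by (simp add: marginal_def)
    qed
    moreover have "marginal f y (set S) \<le> marginal f y (set S - C)"
      using snoc.prems y by (intro marginal_antimono[OF assms(1)]) auto
    ultimately show ?thesis using IH * fy by simp
  qed
qed simp

lemma takeWhile_filter_neq: "P e \<Longrightarrow> takeWhile (\<lambda>t. t \<noteq> e) (filter P S) = filter P (takeWhile (\<lambda>t. t \<noteq> e) S)"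
  by (induction S) auto

text \<open>Filtering only removes predecessors of \<open>e\<close> and appended elements come after
  it, so the value of an element never drops while it stays in the solution.\<close>

lemma incr_value_filter_ge:
  assumes "submodular_on X f" "set S \<subseteq> X" "e \<in> set S" "P e"
  shows "incr_value f e S \<le> incr_value f e (filter P S @ T)"
proof -
  have "incr_value f e (filter P S @ T) = marginal f e (set (filter P (takeWhile (\<lambda>t. t \<noteq> e) S)))"
    using assms by (subst incr_value_append1) (auto simp: incr_value_def takeWhile_filter_neq)
  moreover have "marginal f e (set (takeWhile (\<lambda>t. t \<noteq> e) S))
      \<le> marginal f e (set (filter P (takeWhile (\<lambda>t. t \<noteq> e) S)))"
    using assms by (intro marginal_antimono[OF assms(1)]) (auto dest: set_takeWhileD)
  ultimately show ?thesis by (simp add: incr_value_def)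
qed

section \<open>Finitely supported expectations\<close>

lemma expectation_mono_finite:
  fixes g h :: "'b \<Rightarrow> real"
  assumes "finite (set_pmf P)" "\<And>x. x \<in> set_pmf P \<Longrightarrow> g x \<le> h x"
  shows "measure_pmf.expectation P g \<le> measure_pmf.expectation P h"
  using assms by (intro integral_mono_AE integrable_measure_pmf_finite) (auto simp: AE_measure_pmf_iff)

lemma expectation_bind_finite:
  fixes h :: "'c \<Rightarrow> real"
  assumes "finite (set_pmf P)" "\<And>x. x \<in> set_pmf P \<Longrightarrow> finite (set_pmf (K x))"
  shows "measure_pmf.expectation (P \<bind> K) h
    = measure_pmf.expectation P (\<lambda>x. measure_pmf.expectation (K x) h)"
  by (subst pmf_expectation_bind[of "set_pmf P"], simp_all only: assms)
    (subst integral_measure_pmf[OF assms(1)], auto)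

lemma expectation_const_add:
  fixes h :: "'b \<Rightarrow> real"
  assumes "finite (set_pmf P)"
  shows "measure_pmf.expectation P (\<lambda>x. c + h x) = c + measure_pmf.expectation P h"
  using assms by (simp add: integrable_measure_pmf_finite measure_pmf.prob_space)

text \<open>Processing the elements by decreasing marginal probability makes the telescoping sum of
  expected gains at least \<open>-q * h Z\<close>.\<close>

lemma expectation_gain_ge:
  fixes h :: "'a set \<Rightarrow> real" and A Y :: "'b \<Rightarrow> 'a set"
  assumes "submodular_on X h" "\<And>T. T \<subseteq> X \<Longrightarrow> 0 \<le> h T" "finite (set_pmf P)"
    and "distinct es" "Z \<union> set es \<subseteq> X" "Z \<inter> set es = {}" "\<And>\<omega>. Y \<omega> \<subseteq> Z"
    and "sorted (map (\<lambda>e. - measure_pmf.expectation P (\<lambda>\<omega>. of_bool (e \<in> A \<omega>) :: real)) es)"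
    and "\<And>e. e \<in> set es \<Longrightarrow> measure_pmf.expectation P (\<lambda>\<omega>. of_bool (e \<in> A \<omega>) :: real) \<le> q" "0 \<le> q"
  shows "- q * h Z \<le> measure_pmf.expectation P (\<lambda>\<omega>. h (Y \<omega> \<union> (A \<omega> \<inter> set es)) - h (Y \<omega>))"
  using assms(4-)
proof (induction es arbitrary: Y Z q)
  case Nil
  then show ?case using assms(2)[of Z] by simp
next
  case (Cons e es)
  let ?E = "measure_pmf.expectation P"
  note int = integrable_measure_pmf_finite[OF assms(3)]
  define pr where "pr = ?E (\<lambda>\<omega>. of_bool (e \<in> A \<omega>) :: real)"
  define Y' where "Y' \<omega> = Y \<omega> \<union> (A \<omega> \<inter> {e})" for \<omega>
  have pr0: "0 \<le> pr" unfolding pr_def by (rule integral_nonneg_AE) simp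
  have prq: "pr \<le> q" unfolding pr_def using Cons.prems by simp
  \<comment> \<open>The induction hypothesis is used with \<open>pr\<close> in place of
    \<open>q\<close>; the decreasing order makes \<open>pr\<close> a bound for all remaining
    elements.\<close>
  have "- pr * h (insert e Z) \<le> ?E (\<lambda>\<omega>. h (Y' \<omega> \<union> (A \<omega> \<inter> set es)) - h (Y' \<omega>))"
    using Cons.prems pr0 by (intro Cons.IH) (auto simp: Y'_def pr_def)
  \<comment> \<open>In every outcome the gain of \<open>e\<close> over \<open>Y\<close> is at least
    its gain over the fixed set \<open>Z\<close>, so no independence is required.\<close>
  moreover have "pr * (h (insert e Z) - h Z) \<le> ?E (\<lambda>\<omega>. h (Y' \<omega>) - h (Y \<omega>))"
  proof -
    have "pr * (h (insert e Z) - h Z) = ?E (\<lambda>\<omega>. of_bool (e \<in> A \<omega>) * (h (insert e Z) - h Z))"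
      unfolding pr_def by simp
    also have "\<dots> \<le> ?E (\<lambda>\<omega>. h (Y' \<omega>) - h (Y \<omega>))"
    proof (rule expectation_mono_finite[OF assms(3)])
      fix \<omega>
      have "marginal h e Z \<le> marginal h e (Y \<omega>)"
        using Cons.prems by (intro marginal_antimono[OF assms(1)]) auto
      then show "of_bool (e \<in> A \<omega>) * (h (insert e Z) - h Z) \<le> h (Y' \<omega>) - h (Y \<omega>)"
        by (auto simp: Y'_def marginal_def)
    qed
    finally show ?thesis .
  qed
  moreover have "?E (\<lambda>\<omega>. h (Y \<omega> \<union> (A \<omega> \<inter> set (e # es))) - h (Y \<omega>))
      = ?E (\<lambda>\<omega>. h (Y' \<omega> \<union> (A \<omega> \<inter> set es)) - h (Y' \<omega>)) + ?E (\<lambda>\<omega>. h (Y' \<omega>) - h (Y \<omega>))"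
  proof -
    have "Y \<omega> \<union> (A \<omega> \<inter> set (e # es)) = Y' \<omega> \<union> (A \<omega> \<inter> set es)" for \<omega>
      by (auto simp: Y'_def)
    then show ?thesis by (simp add: int)
  qed
  moreover have "pr * h Z \<le> q * h Z"
    using prq assms(2)[of Z] Cons.prems by (intro mult_right_mono) auto
  ultimately show ?case by (simp add: algebra_simps)
qed

text \<open>Only the probabilities of single elements are bounded; their occurrences may be
  correlated. \<open>expectation_gain_ge\<close> is used with \<open>Y\<close> and \<open>Z\<close>
  empty, after sorting \<open>X\<close> by decreasing probability.\<close>

lemma expectation_random_set_ge:
  fixes h :: "'a set \<Rightarrow> real" and A :: "'b \<Rightarrow> 'a set"
  assumes "finite X" "submodular_on X h" "\<And>T. T \<subseteq> X \<Longrightarrow> 0 \<le> h T" "finite (set_pmf P)"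
    and "\<And>\<omega>. \<omega> \<in> set_pmf P \<Longrightarrow> A \<omega> \<subseteq> X" "0 \<le> q"
    and "\<And>e. e \<in> X \<Longrightarrow> measure_pmf.expectation P (\<lambda>\<omega>. of_bool (e \<in> A \<omega>) :: real) \<le> q"
  shows "(1 - q) * h {} \<le> measure_pmf.expectation P (\<lambda>\<omega>. h (A \<omega>))"
proof -
  obtain xs where xs: "set xs = X" "distinct xs" using finite_distinct_list[OF assms(1)] by auto
  define es where "es = sort_key (\<lambda>e. - measure_pmf.expectation P (\<lambda>\<omega>. of_bool (e \<in> A \<omega>) :: real)) xs"
  have es: "set es = X" "distinct es" using xs by (auto simp: es_def)
  have "- q * h {} \<le> measure_pmf.expectation P (\<lambda>\<omega>. h ({} \<union> (A \<omega> \<inter> set es)) - h {})"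
  proof (rule expectation_gain_ge[OF assms(2-4) es(2)])
    show "sorted (map (\<lambda>e. - measure_pmf.expectation P (\<lambda>\<omega>. of_bool (e \<in> A \<omega>) :: real)) es)"
      unfolding es_def by (rule sorted_sort_key)
  qed (use assms(6,7) es(1) in auto)
  also have "\<dots> = measure_pmf.expectation P (\<lambda>\<omega>. - h {} + h (A \<omega>))"
    using assms(5) es by (intro integral_cong_AE) (auto simp: AE_measure_pmf_iff Int_absorb2)
  also have "\<dots> = - h {} + measure_pmf.expectation P (\<lambda>\<omega>. h (A \<omega>))"
    by (rule expectation_const_add[OF assms(4)])
  finally show ?thesis by (simp add: algebra_simps)
qed

section \<open>One exchange step\<close>

locale matchoid_instance =
  fixes f :: "'a set \<Rightarrow> real" and X :: "'a set" and L :: "'i set"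
    and E :: "'i \<Rightarrow> 'a set" and \<I> :: "'i \<Rightarrow> 'a set set" and p :: nat
    and tie :: "'i \<Rightarrow> 'a \<Rightarrow> 'a list \<Rightarrow> 'a set \<Rightarrow> 'a"
  assumes p_ge_1: "p \<ge> 1"
    and matchoid: "matchoid p X L E \<I>"
    and f_nonneg: "A \<subseteq> X \<Longrightarrow> 0 \<le> f A"
    and f_submodular: "submodular_on X f"
    and tie: "tie_rule tie"
begin

abbreviation "feas \<equiv> feasible X L E \<I>"
abbreviation "qual \<equiv> qualifies f X L E \<I> tie"
abbreviation "exch \<equiv> exchange f L E \<I> tie"

text \<open>\<open>needs_swap\<close>, \<open>candidates\<close> and \<open>victim\<close> split the
  exchange by matroid, since the charging argument follows each matroid separately.\<close>

definition needs_swap :: "'i \<Rightarrow> 'a \<Rightarrow> 'a list \<Rightarrow> bool" where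
  "needs_swap l x S \<longleftrightarrow> l \<in> L \<and> x \<in> E l \<and> insert x (set S \<inter> E l) \<notin> \<I> l"

definition candidates :: "'i \<Rightarrow> 'a \<Rightarrow> 'a list \<Rightarrow> 'a set" where
  "candidates l x S = {y \<in> set S \<inter> E l. insert x (set S \<inter> E l - {y}) \<in> \<I> l}"

definition victim :: "'i \<Rightarrow> 'a \<Rightarrow> 'a list \<Rightarrow> 'a" where
  "victim l x S = tie l x S {y \<in> candidates l x S. \<forall>z \<in> candidates l x S. incr_value f y S \<le> incr_value f z S}"

definition swap :: "'a \<Rightarrow> 'a list \<Rightarrow> 'a list" where
  "swap x S = filter (\<lambda>y. y \<notin> exch x S \<and> y \<noteq> x) S @ [x]"

lemma exchange_eq: "exch x S = (\<lambda>l. victim l x S) ` {l. needs_swap l x S}"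
  unfolding exchange_def victim_def needs_swap_def candidates_def swap_candidates_def
  by (simp add: Let_def)

lemma matchoidD:
  shows finite_X: "finite X" and finite_L: "finite L"
    and E_subset: "l \<in> L \<Longrightarrow> E l \<subseteq> X" and matroid: "l \<in> L \<Longrightarrow> matroid (E l) (\<I> l)"
    and degree_le: "x \<in> X \<Longrightarrow> card {l \<in> L. x \<in> E l} \<le> p"
  using matchoid by (auto simp: matchoid_def)

lemma feasible_mono:
  assumes "feas B" "A \<subseteq> B"
  shows "feas A"
  unfolding feasible_def
proof (intro conjI ballI)
  show "A \<subseteq> X" using assms by (auto simp: feasible_def)
  show "A \<inter> E l \<in> \<I> l" if "l \<in> L" for l
    by (rule matroid_mono[OF matroid[OF that], of "B \<inter> E l"])
      (use assms that in \<open>auto simp: feasible_def\<close>)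
qed

lemma finite_needs_swap: "finite {l. needs_swap l x S}"
  by (rule finite_subset[OF _ finite_L]) (auto simp: needs_swap_def)

text \<open>The candidates together with \<open>x\<close> are dependent while \<open>{x}\<close> is
  independent, so a candidate exists and the minimum is attained.\<close>

lemma victim:
  assumes "feas (set S)" "feas {x}" "needs_swap l x S"
  shows "victim l x S \<in> candidates l x S"
    and "z \<in> candidates l x S \<Longrightarrow> incr_value f (victim l x S) S \<le> incr_value f z S"
proof -
  let ?T = "candidates l x S"
  have l: "l \<in> L" "x \<in> E l" "insert x (set S \<inter> E l) \<notin> \<I> l" using assms(3) by (auto simp: needs_swap_def)
  have fin: "finite ?T" by (simp add: candidates_def)
  have ind: "set S \<inter> E l \<in> \<I> l" using assms(1) l by (simp add: feasible_def)
  have "insert x ?T \<notin> \<I> l"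
    using swap_circuit_dependent[OF matroid[OF l(1)] ind l(3)] by (simp add: candidates_def)
  moreover have "{x} \<inter> E l \<in> \<I> l" using assms(2) l(1) unfolding feasible_def by blast
  ultimately have ne: "?T \<noteq> {}" using l(2) by auto
  have "Min ((\<lambda>y. incr_value f y S) ` ?T) \<in> (\<lambda>y. incr_value f y S) ` ?T"
    using fin ne by (intro Min_in) auto
  then obtain y where y: "y \<in> ?T" "incr_value f y S = Min ((\<lambda>y. incr_value f y S) ` ?T)" by auto
  have "incr_value f y S \<le> incr_value f z S" if "z \<in> ?T" for z
    unfolding y(2) using that fin by simp
  then have "{y \<in> ?T. \<forall>z \<in> ?T. incr_value f y S \<le> incr_value f z S} \<noteq> {}" using y(1) by blast
  then have v: "victim l x S \<in> {y \<in> ?T. \<forall>z \<in> ?T. incr_value f y S \<le> incr_value f z S}"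
    unfolding victim_def by (intro tie[unfolded tie_rule_def, rule_format])
  show "victim l x S \<in> ?T" using v by blast
  show "z \<in> ?T \<Longrightarrow> incr_value f (victim l x S) S \<le> incr_value f z S" using v by blast
qed

lemma exchange_subset:
  assumes "feas (set S)" "feas {x}"
  shows "exch x S \<subseteq> set S"
  using victim(1)[OF assms] unfolding exchange_eq candidates_def by blast

lemma set_swap: "set (swap x S) = insert x (set S - exch x S)"
  by (auto simp: swap_def)

lemma distinct_swap: "distinct S \<Longrightarrow> distinct (swap x S)"
  by (auto simp: swap_def)

lemma feasible_swap:
  assumes "feas (set S)" "feas {x}"
  shows "feas (set (swap x S))"
  unfolding feasible_def
proof (intro conjI ballI)
  show "set (swap x S) \<subseteq> X" using assms by (auto simp: set_swap feasible_def)
next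
  fix l assume l: "l \<in> L"
  have ind: "set S \<inter> E l \<in> \<I> l" using assms(1) l by (simp add: feasible_def)
  note mono = matroid_mono[OF matroid[OF l]]
  show "set (swap x S) \<inter> E l \<in> \<I> l"
  proof (cases "needs_swap l x S")
    case True
    have "insert x (set S \<inter> E l - {victim l x S}) \<in> \<I> l"
      using victim(1)[OF assms True] by (simp add: candidates_def)
    then show ?thesis
      by (rule mono) (use True in \<open>auto simp: set_swap exchange_eq\<close>)
  next
    case False
    show ?thesis
    proof (cases "x \<in> E l")
      case True
      then have "insert x (set S \<inter> E l) \<in> \<I> l" using False l by (simp add: needs_swap_def)
      then show ?thesis by (rule mono) (auto simp: set_swap)
    next
      case False
      show ?thesis by (rule mono[OF ind]) (use False in \<open>auto simp: set_swap\<close>)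
    qed
  qed
qed

text \<open>Nonnegativity of the incremental values has to be carried along, as \<open>f\<close>
  need not be monotone; it makes the sums over exchanged elements nonnegative.\<close>

definition good :: "'a list \<Rightarrow> bool" where
  "good S \<longleftrightarrow> distinct S \<and> feas (set S) \<and> (\<forall>e\<in>set S. 0 \<le> incr_value f e S)"

lemma good_Nil: "good []"
  using matroid_empty[OF matroid] by (auto simp: good_def feasible_def)

lemma qualifiesD:
  assumes "qual \<alpha> \<beta> S x"
  shows "feas {x}" "\<alpha> + (1 + \<beta>) * (\<Sum>e\<in>exch x S. incr_value f e S) \<le> marginal f x (set S)"
  using assms by (auto simp: qualifies_def)

lemma exchange_sum_nonneg:
  assumes "good S" "feas {x}"
  shows "0 \<le> (\<Sum>e\<in>exch x S. incr_value f e S)"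
  using assms exchange_subset[of S x] by (intro sum_nonneg) (auto simp: good_def)

context
  fixes \<alpha> \<beta> :: real and S :: "'a list" and x :: 'a
  assumes \<alpha>_pos: "\<alpha> > 0" and \<beta>_pos: "\<beta> > 0" and good: "good S" and qual: "qual \<alpha> \<beta> S x"
begin

lemma feas_x: "feas {x}" and feas_S: "feas (set S)" and dist_S: "distinct S" and x_in_X: "x \<in> X"
  and S_subset: "set S \<subseteq> X"
  using good qualifiesD(1)[OF qual] by (auto simp: good_def feasible_def)

text \<open>An element of the solution has marginal value 0 and needs no exchange, while its
  threshold is \<alpha> > 0.\<close>

lemma qualifies_notin: "x \<notin> set S"
proof
  assume x: "x \<in> set S"
  then have "insert x (set S \<inter> E l) = set S \<inter> E l" if "x \<in> E l" for l using that by auto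
  then have "{l. needs_swap l x S} = {}" using feas_S by (auto simp: needs_swap_def feasible_def)
  then have "exch x S = {}" unfolding exchange_eq by simp
  moreover have "marginal f x (set S) = 0" using x by (simp add: marginal_def insert_absorb)
  ultimately show False using qualifiesD(2)[OF qual] \<alpha>_pos by simp
qed

lemma swap_value_new: "marginal f x (set S) \<le> incr_value f x (swap x S)"
proof -
  have "incr_value f x (swap x S) = marginal f x (set S - exch x S)"
    unfolding swap_def using qualifies_notin
    by (subst incr_value_append2) (auto intro!: arg_cong[of _ _ "marginal f x"])
  then show ?thesis
    using marginal_antimono[OF f_submodular, of "set S - exch x S" "set S" x] S_subset x_in_X qualifies_notin
    by auto
qed

lemma swap_value_old:
  assumes "e \<in> set S" "e \<notin> exch x S"
  shows "incr_value f e S \<le> incr_value f e (swap x S)"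
  unfolding swap_def using assms qualifies_notin
  by (intro incr_value_filter_ge[OF f_submodular S_subset]) auto

lemma marginal_ge: "\<alpha> + (1 + \<beta>) * (\<Sum>e\<in>exch x S. incr_value f e S) \<le> marginal f x (set S)"
  by (rule qualifiesD(2)[OF qual])

lemma ex_sum_nonneg: "0 \<le> (\<Sum>e\<in>exch x S. incr_value f e S)"
  by (rule exchange_sum_nonneg[OF good feas_x])

lemma marginal_nonneg: "0 \<le> marginal f x (set S)"
proof -
  have "0 \<le> (1 + \<beta>) * (\<Sum>e\<in>exch x S. incr_value f e S)"
    using ex_sum_nonneg \<beta>_pos by (intro mult_nonneg_nonneg) auto
  then show ?thesis using marginal_ge \<alpha>_pos by linarith
qed

lemma good_swap: "good (swap x S)"
proof -
  have "0 \<le> incr_value f e (swap x S)" if "e \<in> set (swap x S)" for e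
  proof (cases "e = x")
    case True
    then show ?thesis using swap_value_new marginal_nonneg by simp
  next
    case False
    then have "e \<in> set S" "e \<notin> exch x S" using that by (auto simp: set_swap)
    then show ?thesis using swap_value_old[of e] good by (force simp: good_def)
  qed
  then show ?thesis
    using distinct_swap[OF dist_S] feasible_swap[OF feas_S feas_x] by (simp add: good_def)
qed

text \<open>Removing \<open>exch x S\<close> costs at most the sum of its incremental values, and
  \<open>x\<close> is worth at least as much over the reduced set as over
  \<open>set S\<close>.\<close>

lemma swap_gain:
  "f (set S) + marginal f x (set S) - (\<Sum>e\<in>exch x S. incr_value f e S) \<le> f (set (swap x S))"
proof -
  have sub: "exch x S \<subseteq> set S" by (rule exchange_subset[OF feas_S feas_x])
  have "f (set (swap x S)) = f (set S - exch x S) + marginal f x (set S - exch x S)"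
    by (simp add: set_swap marginal_def)
  moreover have "marginal f x (set S) \<le> marginal f x (set S - exch x S)"
    using S_subset x_in_X qualifies_notin by (intro marginal_antimono[OF f_submodular]) auto
  moreover have "f (set S) - (\<Sum>c\<in>exch x S. incr_value f c S) \<le> f (set S - exch x S)"
    using removal_value_ge[OF f_submodular dist_S S_subset, of "exch x S"] sub by (simp add: Int_absorb2)
  ultimately show ?thesis by linarith
qed

lemma swap_gain_threshold:
  "f (set S) + \<alpha> + \<beta> * (\<Sum>e\<in>exch x S. incr_value f e S) \<le> f (set (swap x S))"
  using swap_gain marginal_ge by (simp add: algebra_simps)

lemma swap_gain_ge: "f (set S) + \<alpha> \<le> f (set (swap x S))"
proof -
  have "0 \<le> \<beta> * (\<Sum>e\<in>exch x S. incr_value f e S)"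
    using ex_sum_nonneg \<beta>_pos by (intro mult_nonneg_nonneg) auto
  then show ?thesis using swap_gain_threshold by linarith
qed

end

section \<open>Charging rejected elements\<close>

text \<open>\<open>w l d\<close> is the total incremental value that \<open>d\<close> had when it was discarded by exchanges in which
  matroid \<open>l\<close> did not select it. An element removed by \<open>l\<close> itself leaves no weight behind
  in \<open>l\<close>, since it stays in the span of the rest of its circuit.\<close>

definition heavy :: "'a list \<Rightarrow> ('i \<Rightarrow> 'a \<Rightarrow> real) \<Rightarrow> 'i \<Rightarrow> real \<Rightarrow> 'a set" where
  "heavy S w l \<theta> = {s \<in> set S \<inter> E l. \<theta> \<le> incr_value f s S} \<union> {d \<in> E l. \<theta> \<le> w l d}"

definition add_dead :: "'a \<Rightarrow> 'a list \<Rightarrow> ('i \<Rightarrow> 'a \<Rightarrow> real) \<Rightarrow> 'i \<Rightarrow> 'a \<Rightarrow> real" where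
  "add_dead x S w l d = w l d +
     (if d \<in> exch x S \<and> d \<in> E l \<and> \<not> (needs_swap l x S \<and> victim l x S = d) then incr_value f d S else 0)"

text \<open>The amount \<open>c l\<close> is what \<open>e\<close> charges to matroid
  \<open>l\<close>. The span condition for all thresholds up to \<open>c l\<close> replaces a
  pointer to a concrete exchange partner, which may be discarded later, whereas spans survive
  further exchanges.\<close>

definition charged ::
  "real \<Rightarrow> real \<Rightarrow> 'a list \<Rightarrow> ('i \<Rightarrow> 'a \<Rightarrow> real) \<Rightarrow> 'a set \<Rightarrow> 'a \<Rightarrow> bool" where
  "charged \<alpha> \<beta> S w A e \<longleftrightarrow> (\<exists>c. (\<forall>l\<in>L. 0 \<le> c l \<and> (\<forall>\<theta>>0. \<theta> \<le> c l \<longrightarrow> e \<in> mspan (E l) (\<I> l) (heavy S w l \<theta>)))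
     \<and> marginal f e A \<le> \<alpha> + (1 + \<beta>) * (\<Sum>l\<in>L. c l))"

lemma heavy_subset: "heavy S w l \<theta> \<subseteq> E l"
  by (auto simp: heavy_def)

text \<open>The candidates are the fundamental circuit of \<open>x\<close> without \<open>x\<close>
  itself.\<close>

lemma mspan_of_candidates:
  assumes "feas (set S)" "feas {x}" "needs_swap l x S" "candidates l x S \<subseteq> V"
  shows "x \<in> mspan (E l) (\<I> l) V"
proof -
  have l: "l \<in> L" "x \<in> E l" "insert x (set S \<inter> E l) \<notin> \<I> l" using assms(3) by (auto simp: needs_swap_def)
  have ind: "set S \<inter> E l \<in> \<I> l" using assms(1) l by (simp add: feasible_def)
  have "insert x (candidates l x S) \<notin> \<I> l"
    using swap_circuit_dependent[OF matroid[OF l(1)] ind l(3)] by (simp add: candidates_def)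
  moreover have "candidates l x S \<in> \<I> l"
    by (rule matroid_mono[OF matroid[OF l(1)] ind]) (auto simp: candidates_def)
  ultimately show ?thesis using l(2) assms(4) by (auto simp: mspan_def)
qed

text \<open>In each matroid the charge is the value of the would-be victim. As this is a cheapest
  candidate, every threshold up to the charge keeps all candidates inside
  \<open>heavy\<close>.\<close>

lemma not_qualifies_charged:
  assumes "good S" "feas {e}" "\<not> qual \<alpha> \<beta> S e" "set S \<subseteq> A" "A \<subseteq> X" "e \<notin> A" "\<beta> > 0"
  shows "charged \<alpha> \<beta> S w A e"
  unfolding charged_def
proof (intro exI conjI ballI allI impI)
  let ?c = "\<lambda>l. if needs_swap l e S then incr_value f (victim l e S) S else 0"
  have feasS: "feas (set S)" using assms(1) by (simp add: good_def)
  note v = victim[OF feasS assms(2)]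
  have vS: "victim l e S \<in> set S" if "needs_swap l e S" for l
    using v(1)[OF that] by (auto simp: candidates_def)
  then show "0 \<le> ?c l" for l using assms(1) by (auto simp: good_def)
  show "e \<in> mspan (E l) (\<I> l) (heavy S w l \<theta>)" if "\<theta> > 0" "\<theta> \<le> ?c l" for l \<theta>
  proof -
    have l: "needs_swap l e S" using that by (auto split: if_splits)
    have "candidates l e S \<subseteq> heavy S w l \<theta>"
      using that v(2)[OF l] l by (force simp: candidates_def heavy_def)
    then show ?thesis by (rule mspan_of_candidates[OF feasS assms(2) l])
  qed
  \<comment> \<open>Several matroids may select the same victim, which the left side counts once;
    nonnegative values give the inequality.\<close>
  have "(\<Sum>d\<in>exch e S. incr_value f d S) \<le> (\<Sum>l | needs_swap l e S. incr_value f (victim l e S) S)"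
    unfolding exchange_eq using vS assms(1) finite_needs_swap
    by (intro sum_image_le[where g = "\<lambda>d. incr_value f d S", unfolded comp_def]) (auto simp: good_def)
  also have "\<dots> = (\<Sum>l\<in>L. ?c l)"
    using finite_L by (subst sum.inter_filter[symmetric]) (auto simp: needs_swap_def intro!: sum.cong)
  finally have le: "(\<Sum>d\<in>exch e S. incr_value f d S) \<le> (\<Sum>l\<in>L. ?c l)" .
  have eX: "e \<in> X" using assms(2) by (simp add: feasible_def)
  have "marginal f e A \<le> marginal f e (set S)"
    using assms eX by (intro marginal_antimono[OF f_submodular]) auto
  also have "\<dots> \<le> \<alpha> + (1 + \<beta>) * (\<Sum>d\<in>exch e S. incr_value f d S)"
    using assms(2,3) by (auto simp: qualifies_def)
  also have "\<dots> \<le> \<alpha> + (1 + \<beta>) * (\<Sum>l\<in>L. ?c l)"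
    using le assms(7) by simp
  finally show "marginal f e A \<le> \<alpha> + (1 + \<beta>) * (\<Sum>l\<in>L. ?c l)" .
qed

context
  fixes \<alpha> \<beta> :: real and S :: "'a list" and x :: 'a
  assumes \<alpha>_pos: "\<alpha> > 0" and \<beta>_pos: "\<beta> > 0" and good: "good S" and qual: "qual \<alpha> \<beta> S x"
begin

text \<open>Dead weight stays, surviving elements do not lose value, and an element discarded only
  on behalf of other matroids turns into dead weight for \<open>l\<close>. The victim of
  \<open>l\<close> itself is spanned by the rest of its circuit, all of which is heavy after the
  swap.\<close>

lemma heavy_swap_span:
  assumes "l \<in> L" "\<theta> > 0" "\<And>d. 0 \<le> w l d"
  shows "heavy S w l \<theta> \<subseteq> mspan (E l) (\<I> l) (heavy (swap x S) (add_dead x S w) l \<theta>)"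
    (is "_ \<subseteq> mspan _ _ ?V'")
proof
  note fx = feas_x[OF \<alpha>_pos \<beta>_pos good qual] and fS = feas_S[OF \<alpha>_pos \<beta>_pos good qual]
  have nonneg: "0 \<le> incr_value f s S" if "s \<in> set S" for s using good that by (simp add: good_def)
  have sub: "exch x S \<subseteq> set S" by (rule exchange_subset[OF fS fx])
  have keep: "s \<in> ?V'"
    if s: "s \<in> set S" "s \<in> E l" "\<theta> \<le> incr_value f s S" "\<not> (needs_swap l x S \<and> victim l x S = s)" for s
  proof (cases "s \<in> exch x S")
    case True
    then show ?thesis using s assms(3)[of s] by (auto simp: heavy_def add_dead_def)
  next
    case False
    then show ?thesis
      using s swap_value_old[OF \<alpha>_pos \<beta>_pos good qual s(1)] by (auto simp: heavy_def set_swap)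
  qed
  fix e assume e: "e \<in> heavy S w l \<theta>"
  show "e \<in> mspan (E l) (\<I> l) ?V'"
  proof (cases "\<theta> \<le> w l e")
    case True
    also have "w l e \<le> add_dead x S w l e" using nonneg[of e] sub by (auto simp: add_dead_def)
    finally have "e \<in> ?V'" using e by (auto simp: heavy_def)
    then show ?thesis using mspan_superset[OF heavy_subset] by blast
  next
    case False
    then have s: "e \<in> set S" "e \<in> E l" "\<theta> \<le> incr_value f e S" using e by (auto simp: heavy_def)
    show ?thesis
    proof (cases "needs_swap l x S \<and> victim l x S = e")
      case False
      then show ?thesis using keep[OF s False] mspan_superset[OF heavy_subset] by blast
    next
      case True
      then have l: "needs_swap l x S" "victim l x S = e" by auto
      note v = victim[OF fS fx l(1)]
      let ?T = "candidates l x S"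
      \<comment> \<open>The threshold passed by \<open>x\<close> includes the value of
        \<open>e\<close>, so \<open>x\<close> enters with at least the value of the victim it
        replaces.\<close>
      have "e \<in> exch x S" using l unfolding exchange_eq by blast
      then have "incr_value f e S \<le> (\<Sum>d\<in>exch x S. incr_value f d S)"
        using sub nonneg finite_subset[OF sub]
        by (intro member_le_sum) auto
      also have "\<dots> \<le> marginal f x (set S)"
      proof -
        have "0 \<le> \<beta> * (\<Sum>d\<in>exch x S. incr_value f d S)"
          using ex_sum_nonneg[OF \<alpha>_pos \<beta>_pos good qual] \<beta>_pos by (intro mult_nonneg_nonneg) auto
        then show ?thesis
          using marginal_ge[OF \<alpha>_pos \<beta>_pos good qual] \<alpha>_pos by (simp add: algebra_simps)
      qed
      also have "\<dots> \<le> incr_value f x (swap x S)" by (rule swap_value_new[OF \<alpha>_pos \<beta>_pos good qual])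
      finally have "x \<in> ?V'"
        using s(3) l(1) by (auto simp: heavy_def set_swap needs_swap_def)
      moreover have "?T - {e} \<subseteq> ?V'"
      proof
        fix t assume t: "t \<in> ?T - {e}"
        then have "\<theta> \<le> incr_value f t S" using v(2)[of t] l(2) s(3) by auto
        then show "t \<in> ?V'" using t l(2) by (intro keep) (auto simp: candidates_def)
      qed
      ultimately have sub: "insert x (?T - {e}) \<subseteq> ?V'" by blast
      have ind: "set S \<inter> E l \<in> \<I> l" using fS assms(1) by (simp add: feasible_def)
      have eT: "e \<in> ?T" using v(1) l(2) by simp
      then have "insert x (set S \<inter> E l - {e}) \<in> \<I> l" by (simp add: candidates_def)
      then have "insert x (?T - {e}) \<in> \<I> l"
        by (rule matroid_mono[OF matroid[OF assms(1)]]) (auto simp: candidates_def)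
      moreover have "insert e (insert x (?T - {e})) \<notin> \<I> l"
      proof -
        have "insert x ?T \<notin> \<I> l"
          using swap_circuit_dependent[OF matroid[OF assms(1)] ind] l(1)
          by (simp add: candidates_def needs_swap_def)
        moreover have "insert e (insert x (?T - {e})) = insert x ?T" using eT by auto
        ultimately show ?thesis by simp
      qed
      ultimately show ?thesis using sub s(2) by (auto simp: mspan_def)
    qed
  qed
qed

text \<open>The amounts \<open>c\<close> are kept: spans persist by \<open>heavy_swap_span\<close>
  and \<open>mspan_trans\<close>, and the marginal value of \<open>e\<close> only falls as
  \<open>A\<close> grows.\<close>

lemma charged_swap:
  assumes "charged \<alpha>' \<beta>' S w A e" "\<And>l d. 0 \<le> w l d" "e \<notin> A" "e \<noteq> x" "insert e A \<subseteq> X"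
  shows "charged \<alpha>' \<beta>' (swap x S) (add_dead x S w) (insert x A) e"
proof -
  obtain c where c: "\<And>l. l \<in> L \<Longrightarrow> 0 \<le> c l"
    "\<And>l \<theta>. l \<in> L \<Longrightarrow> \<theta> > 0 \<Longrightarrow> \<theta> \<le> c l \<Longrightarrow> e \<in> mspan (E l) (\<I> l) (heavy S w l \<theta>)"
    "marginal f e A \<le> \<alpha>' + (1 + \<beta>') * (\<Sum>l\<in>L. c l)"
    using assms(1) unfolding charged_def by metis
  have "marginal f e (insert x A) \<le> marginal f e A"
    using assms x_in_X[OF \<alpha>_pos \<beta>_pos good qual] by (intro marginal_antimono[OF f_submodular]) auto
  then have "marginal f e (insert x A) \<le> \<alpha>' + (1 + \<beta>') * (\<Sum>l\<in>L. c l)" using c(3) by linarith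
  moreover have "e \<in> mspan (E l) (\<I> l) (heavy (swap x S) (add_dead x S w) l \<theta>)"
    if "l \<in> L" "\<theta> > 0" "\<theta> \<le> c l" for l \<theta>
    by (rule mspan_trans[OF matroid heavy_swap_span c(2)]) (use that assms(2) in auto)
  ultimately show ?thesis using c(1) unfolding charged_def by blast
qed

lemma add_dead_nonneg:
  assumes "\<And>l d. 0 \<le> w l d"
  shows "0 \<le> add_dead x S w l d"
  using assms good exchange_subset[OF feas_S feas_x, OF \<alpha>_pos \<beta>_pos good qual \<alpha>_pos \<beta>_pos good qual]
  by (auto simp: add_dead_def good_def intro!: add_nonneg_nonneg)

text \<open>A discarded \<open>d\<close> lies in at most \<open>p\<close> matroids and at least one
  of them selected it, so at most \<open>p - 1\<close> others record its value.\<close>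

lemma add_dead_sum:
  "(\<Sum>l\<in>L. \<Sum>d\<in>X. add_dead x S w l d)
    \<le> (\<Sum>l\<in>L. \<Sum>d\<in>X. w l d) + (real p - 1) * (\<Sum>d\<in>exch x S. incr_value f d S)"
proof -
  note fx = feas_x[OF \<alpha>_pos \<beta>_pos good qual] and fS = feas_S[OF \<alpha>_pos \<beta>_pos good qual]
  have sub: "exch x S \<subseteq> set S" by (rule exchange_subset[OF fS fx])
  have subX: "exch x S \<subseteq> X" using sub S_subset[OF \<alpha>_pos \<beta>_pos good qual] by blast
  define Q where "Q d = {l \<in> L. d \<in> E l \<and> \<not> (needs_swap l x S \<and> victim l x S = d)}" for d
  have cardQ: "real (card (Q d)) \<le> real p - 1" if d: "d \<in> exch x S" for d
  proof -
    obtain l where l: "needs_swap l x S" "victim l x S = d" using d unfolding exchange_eq by blast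
    have "d \<in> E l" using victim(1)[OF fS fx l(1)] l(2) by (simp add: candidates_def)
    then have lL: "l \<in> {l \<in> L. d \<in> E l}" using l(1) by (simp add: needs_swap_def)
    have "Q d \<subseteq> {l \<in> L. d \<in> E l} - {l}" using l by (auto simp: Q_def)
    then have "card (Q d) \<le> card ({l \<in> L. d \<in> E l} - {l})" using finite_L by (intro card_mono) auto
    also have "\<dots> < card {l \<in> L. d \<in> E l}" using lL finite_L by (intro card_Diff1_less) auto
    also have "\<dots> \<le> p" using degree_le d subX by blast
    finally show ?thesis by linarith
  qed
  have "(\<Sum>l\<in>L. \<Sum>d\<in>X. add_dead x S w l d) - (\<Sum>l\<in>L. \<Sum>d\<in>X. w l d)
      = (\<Sum>l\<in>L. \<Sum>d\<in>X. if d \<in> exch x S \<and> l \<in> Q d then incr_value f d S else 0)"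
    by (auto simp: add_dead_def sum.distrib Q_def intro!: sum.cong)
  also have "\<dots> = (\<Sum>d\<in>X. \<Sum>l\<in>L. if d \<in> exch x S \<and> l \<in> Q d then incr_value f d S else 0)"
    by (rule sum.swap)
  also have "\<dots> = (\<Sum>d\<in>X. if d \<in> exch x S then real (card (Q d)) * incr_value f d S else 0)"
  proof (rule sum.cong[OF refl])
    fix d
    have "(\<Sum>l\<in>L. if l \<in> Q d then incr_value f d S else 0) = (\<Sum>l\<in>Q d. incr_value f d S)"
      unfolding sum.inter_filter[OF finite_L, symmetric] by (intro sum.cong) (auto simp: Q_def)
    then show "(\<Sum>l\<in>L. if d \<in> exch x S \<and> l \<in> Q d then incr_value f d S else 0)
        = (if d \<in> exch x S then real (card (Q d)) * incr_value f d S else 0)" by simp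
  qed
  also have "\<dots> = (\<Sum>d\<in>exch x S. real (card (Q d)) * incr_value f d S)"
    unfolding sum.inter_filter[OF finite_X, symmetric] using subX by (intro sum.cong) auto
  also have "\<dots> \<le> (\<Sum>d\<in>exch x S. (real p - 1) * incr_value f d S)"
    using cardQ good sub by (intro sum_mono mult_right_mono) (auto simp: good_def)
  also have "\<dots> = (real p - 1) * (\<Sum>d\<in>exch x S. incr_value f d S)"
    by (simp add: sum_distrib_left)
  finally show ?thesis by linarith
qed

end

end

section \<open>One pass over the stream\<close>

text \<open>For nonempty \<open>B\<close>, inserting a uniformly random element loses on average at
  most the fraction \<open>1 / card B\<close> of \<open>f Z\<close>. This follows from
  \<open>f (Z \<union> B) \<ge> 0\<close> and submodularity; elements already in \<open>Z\<close>
  have marginal value 0.\<close>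

lemma sum_submodular_insert_ge:
  assumes "submodular_on X f" "\<And>A. A \<subseteq> X \<Longrightarrow> 0 \<le> f A" "finite B" "Z \<union> B \<subseteq> X"
  shows "(real (card B) - 1) * f Z \<le> (\<Sum>x\<in>B. f (insert x Z))"
proof -
  have "0 \<le> f (Z \<union> (B - Z))" using assms(2,4) by auto
  also have "\<dots> \<le> f Z + (\<Sum>x\<in>B - Z. marginal f x Z)"
    using assms by (intro submodular_union_le[OF assms(1)]) auto
  also have "(\<Sum>x\<in>B - Z. marginal f x Z) = (\<Sum>x\<in>B. marginal f x Z)"
    using assms(3) by (intro sum.mono_neutral_left) (auto simp: marginal_def insert_absorb)
  also have "\<dots> = (\<Sum>x\<in>B. f (insert x Z)) - real (card B) * f Z"
    by (simp add: marginal_def sum_subtractf)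
  finally show ?thesis by (simp add: algebra_simps)
qed

context matchoid_instance
begin

abbreviation "process \<equiv> process_stream f X L E \<I> tie"

definition prune :: "real \<Rightarrow> real \<Rightarrow> 'a \<Rightarrow> 'a list \<Rightarrow> 'a set \<Rightarrow> 'a set" where
  "prune \<alpha> \<beta> x S B = {x' \<in> B - {x}. qual \<alpha> \<beta> (swap x S) x'}"

lemma buffer_step_eq:
  "buffer_step f X L E \<I> tie \<alpha> \<beta> (S, B)
    = map_pmf (\<lambda>x. (swap x S, prune \<alpha> \<beta> x S B)) (pmf_of_set B)"
  unfolding buffer_step_def swap_def prune_def by (simp add: map_pmf_def Let_def)

lemma set_arrival:
  assumes "x \<in> X" "B \<subseteq> X"
  shows "set_pmf (arrival f X L E \<I> tie \<alpha> \<beta> m x (S, B)) =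
    (if qual \<alpha> \<beta> S x
     then if card (insert x B) = m then (\<lambda>y. (swap y S, prune \<alpha> \<beta> y S (insert x B))) ` insert x B
       else {(S, insert x B)}
     else {(S, B)})"
proof -
  have "finite (insert x B)" using assms finite_X finite_subset by blast
  then show ?thesis unfolding arrival_def by (auto simp: buffer_step_eq)
qed

text \<open>An invariant rule for predicates that do not see the rest of the stream; the finite
  support it yields justifies splitting expectations.\<close>

lemma process_stream_support:
  assumes "\<And>S B. J S B \<Longrightarrow> B \<subseteq> X"
    and add: "\<And>x S B. J S B \<Longrightarrow> x \<in> X \<Longrightarrow> qual \<alpha> \<beta> S x \<Longrightarrow> J S (insert x B)"
    and step: "\<And>x S B. J S B \<Longrightarrow> x \<in> B \<Longrightarrow> J (swap x S) (prune \<alpha> \<beta> x S B)"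
    and "set xs \<subseteq> X" "J S B"
  shows "finite (set_pmf (process \<alpha> \<beta> m xs (S, B)))
    \<and> (\<forall>(S', B')\<in>set_pmf (process \<alpha> \<beta> m xs (S, B)). J S' B')"
  using assms(4,5)
proof (induction xs arbitrary: S B)
  case (Cons x xs)
  let ?K = "set_pmf (arrival f X L E \<I> tie \<alpha> \<beta> m x (S, B))"
  have x: "x \<in> X" and xs: "set xs \<subseteq> X" using Cons.prems by auto
  have BX: "B \<subseteq> X" using assms(1) Cons.prems by blast
  have fin: "finite ?K"
    unfolding set_arrival[OF x BX] using finite_subset[OF BX finite_X] by auto
  have J: "J S' B'" if "(S', B') \<in> ?K" for S' B'
    using that Cons.prems(2) add[OF Cons.prems(2) x] step[OF add[OF Cons.prems(2) x]]
    unfolding set_arrival[OF x BX] by (auto split: if_splits)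
  have IH: "finite (set_pmf (process \<alpha> \<beta> m xs s)) \<and> (\<forall>(S', B')\<in>set_pmf (process \<alpha> \<beta> m xs s). J S' B')"
    if "s \<in> ?K" for s
    using Cons.IH[OF xs J, of "fst s" "snd s"] that by simp
  then have "finite (\<Union>s\<in>?K. set_pmf (process \<alpha> \<beta> m xs s))" using fin by blast
  then show ?case using IH by (fastforce simp: set_bind_pmf)
qed auto

text \<open>A submartingale rule. The ghost state \<open>g\<close> records history that the
  algorithm does not store and changes only at emptying steps. The potential ignores the buffer, so
  \<open>gain\<close> is the only condition in which randomness enters.\<close>

lemma process_stream_expectation_ge:
  fixes G :: "'a list \<times> 'a set \<Rightarrow> real"
  assumes sub: "\<And>g xs S B. Inv g xs S B \<Longrightarrow> B \<subseteq> X"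
    and base: "\<And>g S B. Inv g [] S B \<Longrightarrow> \<Phi> g S \<le> G (S, B)"
    and skip: "\<And>g x xs S B. Inv g (x # xs) S B \<Longrightarrow> x \<in> X \<Longrightarrow> \<not> qual \<alpha> \<beta> S x \<Longrightarrow> Inv g xs S B"
    and add: "\<And>g x xs S B. Inv g (x # xs) S B \<Longrightarrow> x \<in> X \<Longrightarrow> qual \<alpha> \<beta> S x \<Longrightarrow> Inv g xs S (insert x B)"
    and step: "\<And>g xs S B x. Inv g xs S B \<Longrightarrow> x \<in> B \<Longrightarrow> Inv (upd g x S) xs (swap x S) (prune \<alpha> \<beta> x S B)"
    and gain: "\<And>g xs S B. Inv g xs S B \<Longrightarrow> card B = m \<Longrightarrow>
      real m * \<Phi> g S \<le> (\<Sum>x\<in>B. \<Phi> (upd g x S) (swap x S))"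
    and "set xs \<subseteq> X" "Inv g xs S B"
  shows "\<Phi> g S \<le> measure_pmf.expectation (process \<alpha> \<beta> m xs (S, B)) G"
  using assms(7,8)
proof (induction xs arbitrary: g S B)
  case Nil
  then show ?case using base by simp
next
  case (Cons x xs)
  have x: "x \<in> X" and xs: "set xs \<subseteq> X" using Cons.prems by auto
  have BX: "B \<subseteq> X" by (rule sub[OF Cons.prems(2)])
  show ?case
  proof (cases "qual \<alpha> \<beta> S x")
    case False
    then show ?thesis using Cons.IH[OF xs skip[OF Cons.prems(2) x False]]
      by (simp add: arrival_def bind_return_pmf)
  next
    case True
    let ?B = "insert x B"
    \<comment> \<open>The invariant is needed for the momentarily full buffer, from which the random
      element is drawn.\<close>
    note Inv = add[OF Cons.prems(2) x True]
    show ?thesis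
    proof (cases "card ?B = m")
      case False
      then show ?thesis using Cons.IH[OF xs Inv] True by (simp add: arrival_def bind_return_pmf)
    next
      case m: True
      have fin: "finite ?B" using BX x finite_X finite_subset by blast
      then have mpos: "real m > 0" using m by (auto simp: card_gt_0_iff)
      let ?K = "\<lambda>y. process \<alpha> \<beta> m xs (swap y S, prune \<alpha> \<beta> y S ?B)"
      have eq: "process \<alpha> \<beta> m (x # xs) (S, B) = pmf_of_set ?B \<bind> ?K"
        using True m by (simp add: arrival_def buffer_step_eq bind_map_pmf)
      have supp: "finite (set_pmf (?K y))" for y
        using process_stream_support[where J = "\<lambda>S B. B \<subseteq> X" and \<alpha> = \<alpha> and \<beta> = \<beta> and m = m
            and xs = xs and S = "swap y S" and B = "prune \<alpha> \<beta> y S ?B"] xs BX x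
        by (auto simp: prune_def)
      have "real m * \<Phi> g S \<le> (\<Sum>y\<in>?B. \<Phi> (upd g y S) (swap y S))" by (rule gain[OF Inv m])
      also have "\<dots> \<le> (\<Sum>y\<in>?B. measure_pmf.expectation (?K y) G)"
        by (intro sum_mono Cons.IH[OF xs] step[OF Inv])
      also have "\<dots> = real m * measure_pmf.expectation (pmf_of_set ?B)
          (\<lambda>y. measure_pmf.expectation (?K y) G)"
        using fin m mpos by (subst integral_pmf_of_set) auto
      also have "\<dots> = real m * measure_pmf.expectation (process \<alpha> \<beta> m (x # xs) (S, B)) G"
        unfolding eq using fin supp by (subst expectation_bind_finite) auto
      finally show ?thesis using mpos by simp
    qed
  qed
qed

text \<open>The invariant also records that buffered elements are feasible singletons, which is what
  lets a swap preserve feasibility.\<close>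

lemma process_feasible:
  assumes "set xs \<subseteq> X" "feas (set S)"
  shows "finite (set_pmf (process \<alpha> \<beta> m xs (S, {})))"
    and "(S', B') \<in> set_pmf (process \<alpha> \<beta> m xs (S, {})) \<Longrightarrow> feas (set S') \<and> B' \<subseteq> X"
proof -
  have *: "finite (set_pmf (process \<alpha> \<beta> m xs (S, {}))) \<and>
    (\<forall>(S', B')\<in>set_pmf (process \<alpha> \<beta> m xs (S, {})). feas (set S') \<and> B' \<subseteq> X \<and> (\<forall>y\<in>B'. feas {y}))"
    by (rule process_stream_support)
      (use assms in \<open>auto simp: prune_def feasible_swap qualifies_def\<close>)
  then show "finite (set_pmf (process \<alpha> \<beta> m xs (S, {})))" by blast
  show "(S', B') \<in> set_pmf (process \<alpha> \<beta> m xs (S, {})) \<Longrightarrow> feas (set S') \<and> B' \<subseteq> X" using * by blast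
qed

lemma process_good:
  assumes "set xs \<subseteq> X" "good S" "\<alpha> > 0" "\<beta> > 0"
    and "(S', B') \<in> set_pmf (process \<alpha> \<beta> m xs (S, {}))"
  shows "good S'"
proof -
  have "finite (set_pmf (process \<alpha> \<beta> m xs (S, {}))) \<and>
    (\<forall>(S', B')\<in>set_pmf (process \<alpha> \<beta> m xs (S, {})). good S' \<and> B' \<subseteq> X \<and> (\<forall>y\<in>B'. qual \<alpha> \<beta> S' y))"
    by (rule process_stream_support) (use assms in \<open>auto simp: prune_def good_swap\<close>)
  then show ?thesis using assms(5) by blast
qed

end

section \<open>Invariants of a pass and the charging bound at its end\<close>

locale streaming_instance = matchoid_instance f X L E \<I> p tie
  for f :: "'a set \<Rightarrow> real" and X :: "'a set" and L :: "'i set"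
    and E :: "'i \<Rightarrow> 'a set" and \<I> :: "'i \<Rightarrow> 'a set set" and p :: nat
    and tie :: "'i \<Rightarrow> 'a \<Rightarrow> 'a list \<Rightarrow> 'a set \<Rightarrow> 'a" +
  fixes OPT :: "'a set" and offline :: "'a set \<Rightarrow> 'a set pmf" and \<gamma> :: real and k :: nat
  assumes is_opt: "is_opt f X L E \<I> OPT"
    and offline: "offline_approx f X L E \<I> offline \<gamma>"
    and k_eq: "k = matchoid_rank X L E \<I>"
begin

lemma OPT_feasible: "feas OPT" and OPT_subset: "OPT \<subseteq> X" and le_OPT: "feas T \<Longrightarrow> f T \<le> f OPT"
  using is_opt by (auto simp: is_opt_def feasible_def)

lemma feasible_subset: "feas T \<Longrightarrow> T \<subseteq> X"
  by (simp add: feasible_def)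

lemma finite_feasible: "finite {T. feas T}"
  by (rule finite_subset[of _ "Pow X"]) (auto simp: feasible_def finite_X)

lemma card_feasible_le: "feas T \<Longrightarrow> card T \<le> k"
  unfolding k_eq matchoid_rank_def using finite_feasible by (intro Max_ge) auto

lemma offline_support:
  assumes "B \<subseteq> X"
  shows "finite (set_pmf (offline B))" "T \<in> set_pmf (offline B) \<Longrightarrow> feas T"
proof -
  have *: "set_pmf (offline B) \<subseteq> {S. S \<subseteq> B \<and> feas S}"
    using offline assms by (simp add: offline_approx_def)
  then show "finite (set_pmf (offline B))" using finite_feasible by (auto intro: finite_subset)
  show "T \<in> set_pmf (offline B) \<Longrightarrow> feas T" using * by auto
qed

lemma offline_ge:
  assumes "B \<subseteq> X" "T \<subseteq> B" "feas T"
  shows "f T \<le> \<gamma> * measure_pmf.expectation (offline B) f"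
proof -
  have "f T \<le> Max (f ` {T. T \<subseteq> B \<and> feas T})"
    using assms finite_feasible by (intro Max_ge) auto
  also have "\<dots> \<le> \<gamma> * measure_pmf.expectation (offline B) f"
    using offline assms(1) by (simp add: offline_approx_def)
  finally show ?thesis .
qed

text \<open>On the whole of \<open>X\<close> the offline algorithm competes with \<open>OPT\<close>,
  yet its feasible output is never better than \<open>OPT\<close>.\<close>

lemma gamma_ge_1:
  assumes "f OPT > 0"
  shows "\<gamma> \<ge> 1"
proof -
  have le: "f OPT \<le> \<gamma> * measure_pmf.expectation (offline X) f"
    by (rule offline_ge[OF order_refl OPT_subset OPT_feasible])
  have "0 \<le> measure_pmf.expectation (offline X) f"
    using offline_support[OF order_refl] f_nonneg feasible_subset
    by (intro integral_nonneg_AE) (auto simp: AE_measure_pmf_iff)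
  moreover have "measure_pmf.expectation (offline X) f \<le> measure_pmf.expectation (offline X) (\<lambda>_. f OPT)"
    using offline_support[OF order_refl] le_OPT by (intro expectation_mono_finite) auto
  then have ub: "measure_pmf.expectation (offline X) f \<le> f OPT" by simp
  ultimately have g0: "\<gamma> > 0" using le assms by (metis linorder_not_less mult_nonpos_nonneg order_trans)
  then have "f OPT \<le> \<gamma> * f OPT" using le ub by (meson less_imp_le mult_left_mono order_trans)
  then show ?thesis using assms by simp
qed

text \<open>Ghost state: \<open>A\<close> is the set of all elements that were in the solution during this pass, \<open>W\<close> the
  total incremental value at removal of all discarded elements.\<close>

fun pass_inv :: "real \<Rightarrow> real \<Rightarrow> 'a list \<Rightarrow> 'a set \<times> real \<times> ('i \<Rightarrow> 'a \<Rightarrow> real)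
    \<Rightarrow> 'a list \<Rightarrow> 'a list \<Rightarrow> 'a set \<Rightarrow> bool" where
  "pass_inv \<alpha> \<beta> S\<^sub>0 (A, W, w) xs S B \<longleftrightarrow>
     good S \<and> set S \<subseteq> A \<and> A \<subseteq> X \<and> B \<subseteq> X \<and> (\<forall>y\<in>B. qual \<alpha> \<beta> S y) \<and> (\<forall>l d. 0 \<le> w l d) \<and>
     f A \<le> f (set S) + W \<and> \<beta> * W \<le> f (set S) - f (set S\<^sub>0) \<and>
     (\<Sum>l\<in>L. \<Sum>d\<in>X. w l d) \<le> (real p - 1) * W \<and>
     (\<forall>e\<in>X - set xs. feas {e} \<longrightarrow> e \<in> A \<union> B \<or> charged \<alpha> \<beta> S w A e)"

fun ghost_step :: "'a set \<times> real \<times> ('i \<Rightarrow> 'a \<Rightarrow> real) \<Rightarrow> 'a \<Rightarrow> 'a list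
    \<Rightarrow> 'a set \<times> real \<times> ('i \<Rightarrow> 'a \<Rightarrow> real)" where
  "ghost_step (A, W, w) x S = (insert x A, W + (\<Sum>e\<in>exch x S. incr_value f e S), add_dead x S w)"

lemma pass_inv_init:
  assumes "good S" "X \<subseteq> set xs"
  shows "pass_inv \<alpha> \<beta> S (set S, 0, \<lambda>_ _. 0) xs S {}"
  using assms by (auto simp: good_def feasible_def)

lemma pass_inv_skip:
  assumes "pass_inv \<alpha> \<beta> S\<^sub>0 g (x # xs) S B" "x \<in> X" "\<not> qual \<alpha> \<beta> S x" "\<beta> > 0"
  shows "pass_inv \<alpha> \<beta> S\<^sub>0 g xs S B"
proof (cases g)
  case (fields A W w)
  have "e \<in> A \<union> B \<or> charged \<alpha> \<beta> S w A e" if "e \<in> X - set xs" "feas {e}" for e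
  proof (cases "e = x")
    case True
    then show ?thesis
      using not_qualifies_charged[of S e \<alpha> \<beta> A w] assms that fields by auto
  next
    case False
    then show ?thesis using assms(1) that unfolding fields by auto
  qed
  then show ?thesis using assms(1) unfolding fields by simp
qed

lemma pass_inv_add:
  assumes "pass_inv \<alpha> \<beta> S\<^sub>0 g (x # xs) S B" "x \<in> X" "qual \<alpha> \<beta> S x"
  shows "pass_inv \<alpha> \<beta> S\<^sub>0 g xs S (insert x B)"
  using assms by (cases g) auto

text \<open>Inserting \<open>x\<close> raises \<open>f A\<close> by at most its marginal value over
  \<open>set S\<close>, and \<open>swap_gain\<close> recovers this value up to the removed
  incremental values, which \<open>W\<close> absorbs. Pruned elements become charged, and earlier
  charges persist.\<close>

lemma pass_inv_step:
  assumes "pass_inv \<alpha> \<beta> S\<^sub>0 g xs S B" "x \<in> B" "\<alpha> > 0" "\<beta> > 0"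
  shows "pass_inv \<alpha> \<beta> S\<^sub>0 (ghost_step g x S) xs (swap x S) (prune \<alpha> \<beta> x S B)"
proof (cases g)
  case (fields A W w)
  let ?e = "\<Sum>e\<in>exch x S. incr_value f e S" and ?w = "add_dead x S w"
  have inv: "good S" "set S \<subseteq> A" "A \<subseteq> X" "B \<subseteq> X" "\<And>y. y \<in> B \<Longrightarrow> qual \<alpha> \<beta> S y" "\<And>l d. 0 \<le> w l d"
    "f A \<le> f (set S) + W" "\<beta> * W \<le> f (set S) - f (set S\<^sub>0)"
    "(\<Sum>l\<in>L. \<Sum>d\<in>X. w l d) \<le> (real p - 1) * W"
    "\<And>e. e \<in> X - set xs \<Longrightarrow> feas {e} \<Longrightarrow> e \<in> A \<union> B \<or> charged \<alpha> \<beta> S w A e"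
    using assms(1) unfolding fields by auto
  note ctxt = assms(3,4) inv(1) inv(5)[OF assms(2)]
  have x: "x \<in> X" using inv(4) assms(2) by blast
  have good': "good (swap x S)" by (rule good_swap[OF ctxt])
  have w': "0 \<le> ?w l d" for l d using add_dead_nonneg[OF ctxt, of w l d] inv(6) by blast
  have sub': "set (swap x S) \<subseteq> insert x A" using inv(2) by (auto simp: set_swap)
  have A': "insert x A \<subseteq> X" using inv(3) x by blast
  \<comment> \<open>\<open>x\<close> may already be in \<open>A\<close>, for instance as a discarded
    element of the initial solution that arrives again; then a nonnegative marginal value
    suffices.\<close>
  have "f (insert x A) \<le> f A + marginal f x (set S)"
  proof (cases "x \<in> A")
    case True
    then show ?thesis using marginal_nonneg[OF ctxt] by (simp add: insert_absorb)
  next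
    case False
    have "marginal f x A \<le> marginal f x (set S)"
      using inv(2) A' False by (intro marginal_antimono[OF f_submodular])
    then show ?thesis by (simp add: marginal_def)
  qed
  then have fA: "f (insert x A) \<le> f (set (swap x S)) + (W + ?e)"
    using inv(7) swap_gain[OF ctxt] by linarith
  have W: "\<beta> * (W + ?e) \<le> f (set (swap x S)) - f (set S\<^sub>0)"
    using inv(8) swap_gain_threshold[OF ctxt] assms(3) by (simp add: algebra_simps)
  have sum_w: "(\<Sum>l\<in>L. \<Sum>d\<in>X. ?w l d) \<le> (real p - 1) * (W + ?e)"
    using inv(9) add_dead_sum[OF ctxt, of w] by (simp add: algebra_simps)
  have "e \<in> insert x A \<union> prune \<alpha> \<beta> x S B \<or> charged \<alpha> \<beta> (swap x S) ?w (insert x A) e"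
    if e: "e \<in> X - set xs" "feas {e}" for e
  proof (cases "e \<in> insert x A \<union> prune \<alpha> \<beta> x S B")
    case False
    then have eA: "e \<notin> A" "e \<noteq> x" by auto
    consider "e \<in> B" | "charged \<alpha> \<beta> S w A e" using inv(10)[OF e] eA by blast
    then have "charged \<alpha> \<beta> (swap x S) ?w (insert x A) e"
    proof cases
      case 1
      then have "\<not> qual \<alpha> \<beta> (swap x S) e" using False by (auto simp: prune_def)
      then show ?thesis
        using eA by (intro not_qualifies_charged[OF good' e(2) _ sub' A' _ assms(4)]) auto
    next
      case 2
      then show ?thesis
        using eA inv(3,6) e(1) by (intro charged_swap[OF ctxt]) auto
    qed
    then show ?thesis by blast
  qed simp
  then show ?thesis
    using good' w' sub' A' fA W sum_w inv(4) unfolding fields by (auto simp: prune_def)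
qed

text \<open>\<open>OPT \<union> A\<close> consists of \<open>A\<close>, the buffered part of
  \<open>OPT\<close>, bounded through the offline algorithm, and the rejected part \<open>R\<close>,
  whose marginal values are bounded by its charges in the matroids.\<close>

lemma OPT_union_bound:
  assumes inv: "pass_inv \<alpha> \<beta> S\<^sub>0 (A, W, w) [] S B" and "\<alpha> \<ge> 0" "\<beta> > 0"
  shows "f (OPT \<union> A) \<le> real k * \<alpha> + real p * (1 + \<beta>)\<^sup>2 / \<beta> * f (set S)
    - (real p / \<beta> + real p - 1) * f (set S\<^sub>0) + \<gamma> * measure_pmf.expectation (offline B) f"
proof -
  have inv: "good S" "set S \<subseteq> A" "A \<subseteq> X" "B \<subseteq> X" "\<And>l d. 0 \<le> w l d"
    "f A \<le> f (set S) + W" "\<beta> * W \<le> f (set S) - f (set S\<^sub>0)"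
    "(\<Sum>l\<in>L. \<Sum>d\<in>X. w l d) \<le> (real p - 1) * W"
    "\<And>e. e \<in> X \<Longrightarrow> feas {e} \<Longrightarrow> e \<in> A \<union> B \<or> charged \<alpha> \<beta> S w A e"
    using inv by auto
  define R where "R = OPT - B - A"
  have RX: "R \<subseteq> X" and finR: "finite R" using OPT_subset finite_X by (auto simp: R_def intro: finite_subset)
  have SX: "set S \<subseteq> X" using inv(2,3) by blast
  have ch: "charged \<alpha> \<beta> S w A e" if "e \<in> R" for e
    using inv(9)[of e] that RX feasible_mono[OF OPT_feasible, of "{e}"] by (auto simp: R_def)
  then obtain c where c:
    "\<And>e l. e \<in> R \<Longrightarrow> l \<in> L \<Longrightarrow> 0 \<le> c e l"
    "\<And>e l \<theta>. e \<in> R \<Longrightarrow> l \<in> L \<Longrightarrow> \<theta> > 0 \<Longrightarrow> \<theta> \<le> c e l \<Longrightarrow> e \<in> mspan (E l) (\<I> l) (heavy S w l \<theta>)"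
    "\<And>e. e \<in> R \<Longrightarrow> marginal f e A \<le> \<alpha> + (1 + \<beta>) * (\<Sum>l\<in>L. c e l)"
    unfolding charged_def by metis
  have nu: "0 \<le> incr_value f s S" if "s \<in> set S" for s using inv(1) that by (simp add: good_def)
  \<comment> \<open>For every \<theta>, the elements of \<open>R\<close> with charge at least
    \<theta> form an independent set in the span of \<open>heavy S w l \<theta>\<close>, hence are
    no more numerous than that set.\<close>
  have per_matroid: "(\<Sum>e\<in>R. c e l) \<le> (\<Sum>s\<in>set S \<inter> E l. incr_value f s S) + (\<Sum>d\<in>E l. w l d)"
    if l: "l \<in> L" for l
  proof -
    have finE: "finite (E l)" by (rule matroid_finite[OF matroid[OF l]])
    let ?b = "case_sum (\<lambda>s. incr_value f s S) (w l)"
    \<comment> \<open>A disjoint sum, because an element can carry dead weight and be in the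
      solution again.\<close>
    let ?J = "(set S \<inter> E l) <+> E l"
    have "(\<Sum>e\<in>R. c e l) \<le> sum ?b ?J"
    proof (rule sum_le_sum_if_card_threshold_le[OF finR])
      show "finite ?J" using finE by auto
      show "0 \<le> ?b j" if "j \<in> ?J" for j using that nu inv(5) by auto
      fix \<theta> :: real assume \<theta>: "\<theta> > 0"
      have fin: "finite (heavy S w l \<theta>)" using heavy_subset finE by (rule finite_subset)
      have sub: "{e \<in> R. \<theta> \<le> c e l} \<subseteq> mspan (E l) (\<I> l) (heavy S w l \<theta>)"
        using c(2) l \<theta> by blast
      then have "{e \<in> R. \<theta> \<le> c e l} \<subseteq> OPT \<inter> E l" by (auto simp: mspan_def R_def)
      moreover have "OPT \<inter> E l \<in> \<I> l" using OPT_feasible l by (simp add: feasible_def)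
      ultimately have "{e \<in> R. \<theta> \<le> c e l} \<in> \<I> l" by (rule matroid_mono[OF matroid[OF l], rotated])
      then have "card {e \<in> R. \<theta> \<le> c e l} \<le> card (heavy S w l \<theta>)"
        by (rule card_independent_le[OF matroid[OF l] _ sub fin])
      also have "\<dots> \<le> card {s \<in> set S \<inter> E l. \<theta> \<le> incr_value f s S} + card {d \<in> E l. \<theta> \<le> w l d}"
        unfolding heavy_def by (rule card_Un_le)
      also have "\<dots> = card ({s \<in> set S \<inter> E l. \<theta> \<le> incr_value f s S} <+> {d \<in> E l. \<theta> \<le> w l d})"
        using finE by (subst card_Plus) auto
      also have "{s \<in> set S \<inter> E l. \<theta> \<le> incr_value f s S} <+> {d \<in> E l. \<theta> \<le> w l d}
          = {j \<in> ?J. \<theta> \<le> ?b j}" by auto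
      finally show "card {e \<in> R. \<theta> \<le> c e l} \<le> card {j \<in> ?J. \<theta> \<le> ?b j}" .
    qed
    also have "sum ?b ?J = (\<Sum>s\<in>set S \<inter> E l. incr_value f s S) + (\<Sum>d\<in>E l. w l d)"
      using finE by (subst sum.Plus) (auto simp: comp_def)
    finally show ?thesis .
  qed
  \<comment> \<open>Each solution element is counted by at most \<open>p\<close> matroids, and the
    incremental values telescope to \<open>f (set S) - f {}\<close>.\<close>
  have "(\<Sum>l\<in>L. \<Sum>s\<in>set S \<inter> E l. incr_value f s S)
      = (\<Sum>l\<in>L. \<Sum>s\<in>set S. if s \<in> E l then incr_value f s S else 0)"
    by (simp add: sum.inter_restrict)
  also have "\<dots> = (\<Sum>s\<in>set S. \<Sum>l\<in>L. if s \<in> E l then incr_value f s S else 0)" by (rule sum.swap)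
  also have "\<dots> = (\<Sum>s\<in>set S. real (card {l \<in> L. s \<in> E l}) * incr_value f s S)"
    by (simp add: sum.inter_filter[OF finite_L, symmetric])
  also have "\<dots> \<le> (\<Sum>s\<in>set S. real p * incr_value f s S)"
    using nu degree_le SX by (intro sum_mono mult_right_mono) auto
  also have "\<dots> = real p * (f (set S) - f {})"
    using inv(1) by (simp add: sum_distrib_left[symmetric] sum_incr_value good_def)
  also have "\<dots> \<le> real p * f (set S)" using f_nonneg[of "{}"] by (intro mult_left_mono) auto
  finally have sumS: "(\<Sum>l\<in>L. \<Sum>s\<in>set S \<inter> E l. incr_value f s S) \<le> real p * f (set S)" .
  have "(\<Sum>l\<in>L. \<Sum>d\<in>E l. w l d) \<le> (\<Sum>l\<in>L. \<Sum>d\<in>X. w l d)"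
    using E_subset finite_X inv(5) by (intro sum_mono sum_mono2) auto
  then have sumW: "(\<Sum>l\<in>L. \<Sum>d\<in>E l. w l d) \<le> (real p - 1) * W" using inv(8) by linarith
  have "(\<Sum>e\<in>R. \<Sum>l\<in>L. c e l) = (\<Sum>l\<in>L. \<Sum>e\<in>R. c e l)" by (rule sum.swap)
  also have "\<dots> \<le> (\<Sum>l\<in>L. (\<Sum>s\<in>set S \<inter> E l. incr_value f s S) + (\<Sum>d\<in>E l. w l d))"
    by (intro sum_mono per_matroid)
  also have "\<dots> \<le> real p * f (set S) + (real p - 1) * W"
    using sumS sumW by (simp add: sum.distrib)
  finally have charge: "(\<Sum>e\<in>R. \<Sum>l\<in>L. c e l) \<le> real p * f (set S) + (real p - 1) * W" .
  have "card R \<le> card OPT"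
    using OPT_subset finite_X by (intro card_mono) (auto simp: R_def intro: finite_subset)
  then have cardR: "real (card R) * \<alpha> \<le> real k * \<alpha>"
    using card_feasible_le[OF OPT_feasible] assms(2) by (intro mult_right_mono) auto
  have "(\<Sum>e\<in>R. marginal f e A) \<le> (\<Sum>e\<in>R. \<alpha> + (1 + \<beta>) * (\<Sum>l\<in>L. c e l))"
    by (intro sum_mono c(3))
  also have "\<dots> = real (card R) * \<alpha> + (1 + \<beta>) * (\<Sum>e\<in>R. \<Sum>l\<in>L. c e l)"
    by (simp add: sum.distrib sum_distrib_left)
  also have "\<dots> \<le> real k * \<alpha> + (1 + \<beta>) * (real p * f (set S) + (real p - 1) * W)"
    using cardR charge assms(3) by (intro add_mono mult_left_mono) auto
  finally have marg: "(\<Sum>e\<in>R. marginal f e A)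
      \<le> real k * \<alpha> + (1 + \<beta>) * (real p * f (set S) + (real p - 1) * W)" .
  have "f (A \<union> R) \<le> f A + (\<Sum>e\<in>R. marginal f e A)"
    using inv(3) RX finR by (intro submodular_union_le[OF f_submodular]) (auto simp: R_def)
  moreover have "f (OPT \<union> A) \<le> f (A \<union> R) + f (OPT \<inter> B)"
  proof -
    have "f ((A \<union> R) \<union> (OPT \<inter> B)) + f ((A \<union> R) \<inter> (OPT \<inter> B)) \<le> f (A \<union> R) + f (OPT \<inter> B)"
      using f_submodular[unfolded submodular_on_def, rule_format, of "A \<union> R" "OPT \<inter> B"] inv(3,4) RX by auto
    moreover have "(A \<union> R) \<union> (OPT \<inter> B) = OPT \<union> A" by (auto simp: R_def)
    moreover have "0 \<le> f ((A \<union> R) \<inter> (OPT \<inter> B))" using inv(4) by (intro f_nonneg) auto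
    ultimately show ?thesis by simp
  qed
  moreover have "f (OPT \<inter> B) \<le> \<gamma> * measure_pmf.expectation (offline B) f"
    using inv(4) by (intro offline_ge feasible_mono[OF OPT_feasible]) auto
  ultimately have total: "f (OPT \<union> A) \<le> f (set S) + W + real k * \<alpha>
      + (1 + \<beta>) * (real p * f (set S) + (real p - 1) * W) + \<gamma> * measure_pmf.expectation (offline B) f"
    using inv(6) marg by linarith
  \<comment> \<open>Replacing \<open>W\<close> by its bound
    \<open>(f (set S) - f (set S\<^sub>0)) / \<beta>\<close> produces the two coefficients of the
    statement.\<close>
  have "(1 + (1 + \<beta>) * (real p - 1)) * W
      \<le> (1 + (1 + \<beta>) * (real p - 1)) * ((f (set S) - f (set S\<^sub>0)) / \<beta>)"
    using inv(7) assms(3) p_ge_1 by (intro mult_left_mono) (auto simp: pos_le_divide_eq mult.commute)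
  moreover have "f (set S) + W + (1 + \<beta>) * (real p * f (set S) + (real p - 1) * W)
      = (1 + (1 + \<beta>) * real p) * f (set S) + (1 + (1 + \<beta>) * (real p - 1)) * W"
    by (simp add: algebra_simps)
  moreover have "(1 + (1 + \<beta>) * real p) * f (set S)
      + (1 + (1 + \<beta>) * (real p - 1)) * ((f (set S) - f (set S\<^sub>0)) / \<beta>)
      = real p * (1 + \<beta>)\<^sup>2 / \<beta> * f (set S) - (real p / \<beta> + real p - 1) * f (set S\<^sub>0)"
    using assms(3) by (simp add: field_simps power2_eq_square)
  ultimately show ?thesis using total by linarith
qed

section \<open>Expected value and occupancy after one pass\<close>

abbreviation "rls \<equiv> rand_local_search f X L E \<I> tie offline"
abbreviation "multi \<equiv> multipass f X L E \<I> tie offline"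

lemma rls_eq: "rls \<alpha> \<beta> m xs S = process \<alpha> \<beta> m xs (S, {}) \<bind> (\<lambda>(S, B). map_pmf (Pair S) (offline B))"
  unfolding rand_local_search_def by (simp add: map_pmf_def case_prod_unfold)

lemma rls_support:
  assumes "set xs \<subseteq> X" "feas (set S)"
  shows "finite (set_pmf (rls \<alpha> \<beta> m xs S))"
    and "(T, T') \<in> set_pmf (rls \<alpha> \<beta> m xs S) \<Longrightarrow> feas (set T) \<and> feas T'"
    and "good S \<Longrightarrow> \<alpha> > 0 \<Longrightarrow> \<beta> > 0 \<Longrightarrow> (T, T') \<in> set_pmf (rls \<alpha> \<beta> m xs S) \<Longrightarrow> good T"
proof -
  note feas = process_feasible[OF assms, where \<alpha> = \<alpha> and \<beta> = \<beta> and m = m]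
  have mem: "(T, T') \<in> set_pmf (rls \<alpha> \<beta> m xs S) \<longleftrightarrow>
    (\<exists>B. (T, B) \<in> set_pmf (process \<alpha> \<beta> m xs (S, {})) \<and> T' \<in> set_pmf (offline B))" for T T'
    unfolding rls_eq by (simp add: set_bind_pmf Bex_def image_iff) blast
  show "finite (set_pmf (rls \<alpha> \<beta> m xs S))"
    unfolding rls_eq set_bind_pmf
  proof (rule finite_UN_I[OF feas(1)])
    show "finite (set_pmf (case s of (S, B) \<Rightarrow> map_pmf (Pair S) (offline B)))"
      if s: "s \<in> set_pmf (process \<alpha> \<beta> m xs (S, {}))" for s
    proof -
      obtain T B where TB: "s = (T, B)" by (cases s)
      then have "B \<subseteq> X" using feas(2) s by blast
      then show ?thesis using offline_support(1) by (simp add: TB)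
    qed
  qed
  show "(T, T') \<in> set_pmf (rls \<alpha> \<beta> m xs S) \<Longrightarrow> feas (set T) \<and> feas T'" for T T'
    unfolding mem using feas(2) offline_support(2) by metis
  show "good S \<Longrightarrow> \<alpha> > 0 \<Longrightarrow> \<beta> > 0 \<Longrightarrow> (T, T') \<in> set_pmf (rls \<alpha> \<beta> m xs S) \<Longrightarrow> good T" for T T'
    unfolding mem using process_good[OF assms(1)] by metis
qed

lemma expectation_rls:
  fixes h :: "'a list \<times> 'a set \<Rightarrow> real"
  assumes "set xs \<subseteq> X" "feas (set S)"
  shows "measure_pmf.expectation (rls \<alpha> \<beta> m xs S) h =
    measure_pmf.expectation (process \<alpha> \<beta> m xs (S, {}))
      (\<lambda>(S, B). measure_pmf.expectation (offline B) (\<lambda>S'. h (S, S')))"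
  unfolding rls_eq using process_feasible[OF assms] offline_support
  by (subst expectation_bind_finite) (auto simp: case_prod_unfold)

text \<open>The factor \<open>(f OPT - f S) / \<alpha>\<close> in the potential bounds the number of exchanges that can still
  happen.\<close>

lemma pass_value:
  assumes "good S\<^sub>0" "set xs = X" "\<alpha> > 0" "\<beta> > 0" "m > 0" "f OPT \<le> \<alpha> * real m"
  shows "(1 - f OPT / (\<alpha> * real m)) * f (OPT \<union> set S\<^sub>0)
      + (real p / \<beta> + real p - 1) * f (set S\<^sub>0) - real k * \<alpha>
    \<le> measure_pmf.expectation (rls \<alpha> \<beta> m xs S\<^sub>0)
        (\<lambda>(T, T'). real p * (1 + \<beta>)\<^sup>2 / \<beta> * f (set T) + \<gamma> * f T')"
proof -
  let ?c = "real p * (1 + \<beta>)\<^sup>2 / \<beta>" and ?b = "real p / \<beta> + real p - 1"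
  define r where "r S = 1 - (f OPT - f (set S)) / (\<alpha> * real m)" for S
  define \<Phi> :: "'a set \<times> real \<times> ('i \<Rightarrow> 'a \<Rightarrow> real) \<Rightarrow> 'a list \<Rightarrow> real"
    where "\<Phi> g S = r S * f (OPT \<union> fst g) + ?b * f (set S\<^sub>0) - real k * \<alpha>" for g S
  define G where "G = (\<lambda>(S, B). ?c * f (set S) + \<gamma> * measure_pmf.expectation (offline B) f)"
  have feas0: "feas (set S\<^sub>0)" using assms(1) by (simp add: good_def)
  have mpos: "\<alpha> * real m > 0" using assms by simp
  have r_le: "r S \<le> 1" if "feas (set S)" for S
    using le_OPT[OF that] mpos by (simp add: r_def)
  have r_ge: "1 - f OPT / (\<alpha> * real m) \<le> r S" if "feas (set S)" for S
    using f_nonneg[OF feasible_subset[OF that]] mpos by (simp add: r_def divide_right_mono)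
  have r0: "0 \<le> r S" if "feas (set S)" for S
  proof -
    have "f OPT / (\<alpha> * real m) \<le> 1" using assms(6) mpos by simp
    then show ?thesis using r_ge[OF that] by linarith
  qed
  have "\<Phi> (set S\<^sub>0, 0, \<lambda>_ _. 0) S\<^sub>0 \<le> measure_pmf.expectation (process \<alpha> \<beta> m xs (S\<^sub>0, {})) G"
  proof (rule process_stream_expectation_ge[where Inv = "pass_inv \<alpha> \<beta> S\<^sub>0" and upd = ghost_step])
    fix g xs S B assume "pass_inv \<alpha> \<beta> S\<^sub>0 g xs S B"
    then show "B \<subseteq> X" by (cases g) auto
  next
    fix g S B assume inv: "pass_inv \<alpha> \<beta> S\<^sub>0 g [] S B"
    obtain A W w where g: "g = (A, W, w)" by (cases g)
    have fS: "feas (set S)" and AX: "A \<subseteq> X" using inv g by (auto simp: good_def)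
    have "r S * f (OPT \<union> A) \<le> f (OPT \<union> A)"
      using r_le[OF fS] AX OPT_subset by (intro mult_left_le_one_le f_nonneg r0[OF fS]) auto
    also have "\<dots> \<le> real k * \<alpha> + ?c * f (set S) - ?b * f (set S\<^sub>0)
        + \<gamma> * measure_pmf.expectation (offline B) f"
      using OPT_union_bound[of \<alpha> \<beta> S\<^sub>0 A W w S B] inv g assms by simp
    finally show "\<Phi> g S \<le> G (S, B)" by (simp add: \<Phi>_def G_def g)
  next
    fix g S B xs assume inv: "pass_inv \<alpha> \<beta> S\<^sub>0 g xs S B" and B: "card B = m"
    obtain A W w where g: "g = (A, W, w)" by (cases g)
    have i: "good S" "A \<subseteq> X" "B \<subseteq> X" "\<And>y. y \<in> B \<Longrightarrow> qual \<alpha> \<beta> S y" using inv g by auto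
    have fS: "feas (set S)" using i(1) by (simp add: good_def)
    have finB: "finite B" using B assms(5) card_ge_0_finite by blast
    let ?h = "\<lambda>Z. f (OPT \<union> Z)"
    have h0: "0 \<le> ?h Z" if "Z \<subseteq> X" for Z using that OPT_subset by (intro f_nonneg) auto
    have gain: "r S + 1 / real m \<le> r (swap x S)" if "x \<in> B" for x
    proof -
      have "f (set S) + \<alpha> \<le> f (set (swap x S))"
        by (rule swap_gain_ge[OF assms(3,4) i(1) i(4)[OF that]])
      then have "(f OPT - f (set (swap x S))) / (\<alpha> * real m) \<le> (f OPT - f (set S) - \<alpha>) / (\<alpha> * real m)"
        using mpos by (intro divide_right_mono) auto
      also have "\<dots> = (f OPT - f (set S)) / (\<alpha> * real m) - 1 / real m"
        using assms(3,5) by (simp add: diff_divide_distrib)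
      finally show ?thesis by (simp add: r_def)
    qed
    obtain x where x: "x \<in> B" using B assms(5) by fastforce
    have "feas (set (swap x S))"
      using good_swap[OF assms(3,4) i(1) i(4)[OF x]] by (simp add: good_def)
    then have r_le': "r S + 1 / real m \<le> 1" using gain[OF x] r_le by fastforce
    \<comment> \<open>The factor \<open>r\<close> grows by at least \<open>1 / m\<close>, which
      offsets the average loss of a fraction \<open>1 / m\<close> of
      \<open>f (OPT \<union> A)\<close>. The inequality holds because the increased factor is still
      at most 1.\<close>
    have "real m * r S \<le> (r S + 1 / real m) * (real m - 1)"
      using r_le' assms(5) by (simp add: field_simps)
    then have "real m * r S * ?h A \<le> (r S + 1 / real m) * (real m - 1) * ?h A"
      using h0[OF i(2)] by (intro mult_right_mono)
    also have "\<dots> = (r S + 1 / real m) * ((real (card B) - 1) * ?h A)" by (simp add: B)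
    also have "\<dots> \<le> (r S + 1 / real m) * (\<Sum>x\<in>B. f (insert x (OPT \<union> A)))"
      using i OPT_subset finB r0[OF fS]
      by (intro mult_left_mono sum_submodular_insert_ge[OF f_submodular f_nonneg]) auto
    also have "\<dots> = (\<Sum>x\<in>B. (r S + 1 / real m) * ?h (insert x A))"
      by (simp add: sum_distrib_left)
    also have "\<dots> \<le> (\<Sum>x\<in>B. r (swap x S) * ?h (insert x A))"
      using gain i OPT_subset by (intro sum_mono mult_right_mono f_nonneg) auto
    finally show "real m * \<Phi> g S \<le> (\<Sum>x\<in>B. \<Phi> (ghost_step g x S) (swap x S))"
      by (simp add: \<Phi>_def g sum.distrib sum_subtractf B algebra_simps)
  next
    show "pass_inv \<alpha> \<beta> S\<^sub>0 (set S\<^sub>0, 0, \<lambda>_ _. 0) xs S\<^sub>0 {}" using assms by (intro pass_inv_init) auto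
  qed ((blast intro: pass_inv_skip pass_inv_add pass_inv_step assms | simp add: assms(2))+)
  also have "\<dots> = measure_pmf.expectation (rls \<alpha> \<beta> m xs S\<^sub>0) (\<lambda>(T, T'). ?c * f (set T) + \<gamma> * f T')"
    unfolding expectation_rls[OF eq_refl[OF assms(2)] feas0]
    using process_feasible[OF eq_refl[OF assms(2)] feas0] offline_support
    by (intro integral_cong_AE) (auto simp: AE_measure_pmf_iff G_def expectation_const_add)
  finally have "\<Phi> (set S\<^sub>0, 0, \<lambda>_ _. 0) S\<^sub>0
    \<le> measure_pmf.expectation (rls \<alpha> \<beta> m xs S\<^sub>0) (\<lambda>(T, T'). ?c * f (set T) + \<gamma> * f T')" .
  moreover have "(1 - f OPT / (\<alpha> * real m)) * f (OPT \<union> set S\<^sub>0) \<le> r S\<^sub>0 * f (OPT \<union> set S\<^sub>0)"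
    using r_ge[OF feas0] feasible_subset[OF feas0] OPT_subset by (intro mult_right_mono f_nonneg) auto
  ultimately show ?thesis by (simp add: \<Phi>_def)
qed

text \<open>For fixed \<open>e\<close> the expression is a supermartingale: an emptying step draws
  \<open>e\<close> with probability at most \<open>1 / m\<close>, while the gain of at least
  \<alpha> lowers the second term by at least \<open>1 / m\<close>.\<close>

lemma pass_occupancy:
  assumes "good S\<^sub>0" "set xs \<subseteq> X" "\<alpha> > 0" "\<beta> > 0" "m > 0"
  shows "measure_pmf.expectation (rls \<alpha> \<beta> m xs S\<^sub>0)
      (\<lambda>(T, T'). of_bool (e \<in> set T) + (f OPT - f (set T)) / (\<alpha> * real m))
    \<le> of_bool (e \<in> set S\<^sub>0) + (f OPT - f (set S\<^sub>0)) / (\<alpha> * real m)"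
proof -
  define q :: "'a list \<Rightarrow> real"
    where "q S = of_bool (e \<in> set S) + (f OPT - f (set S)) / (\<alpha> * real m)" for S
  have feas0: "feas (set S\<^sub>0)" using assms(1) by (simp add: good_def)
  \<comment> \<open>The submartingale rule is applied to the negated quantity with a trivial ghost
    state.\<close>
  have "- q S\<^sub>0 \<le> measure_pmf.expectation (process \<alpha> \<beta> m xs (S\<^sub>0, {})) (\<lambda>(S, B). - q S)"
  proof (rule process_stream_expectation_ge[where \<Phi> = "\<lambda>_ S. - q S" and g = "()" and upd = "\<lambda>_ _ _. ()"
        and Inv = "\<lambda>_ _ S B. good S \<and> B \<subseteq> X \<and> (\<forall>y\<in>B. qual \<alpha> \<beta> S y)"])
    fix S B assume inv: "good S \<and> B \<subseteq> X \<and> (\<forall>y\<in>B. qual \<alpha> \<beta> S y)" and B: "card B = m"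
    have finB: "finite B" using B assms(5) card_ge_0_finite by blast
    have "q (swap x S) \<le> q S - 1 / real m + of_bool (e = x)" if x: "x \<in> B" for x
    proof -
      have "f (set S) + \<alpha> \<le> f (set (swap x S))"
        using swap_gain_ge[OF assms(3,4)] inv x by blast
      then have "(f OPT - f (set (swap x S))) / (\<alpha> * real m) \<le> (f OPT - f (set S) - \<alpha>) / (\<alpha> * real m)"
        using assms by (intro divide_right_mono) auto
      also have "\<dots> = (f OPT - f (set S)) / (\<alpha> * real m) - 1 / real m"
        using assms(3,5) by (simp add: diff_divide_distrib)
      finally show ?thesis by (auto simp: q_def set_swap)
    qed
    then have "(\<Sum>x\<in>B. q (swap x S)) \<le> (\<Sum>x\<in>B. q S - 1 / real m + of_bool (e = x))"
      by (intro sum_mono)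
    also have "\<dots> = real m * q S - 1 + (\<Sum>x\<in>B. of_bool (e = x))"
      using assms(5) by (simp add: sum.distrib sum_subtractf B right_diff_distrib)
    also have "(\<Sum>x\<in>B. of_bool (e = x)) \<le> (1::real)"
      using finB by (simp add: of_bool_def sum.delta')
    finally show "real m * - q S \<le> (\<Sum>x\<in>B. - q (swap x S))" by (simp add: sum_negf)
  qed (use assms in \<open>auto simp: prune_def good_swap\<close>)
  also have "\<dots> = measure_pmf.expectation (rls \<alpha> \<beta> m xs S\<^sub>0) (\<lambda>(T, T'). - q T)"
    unfolding expectation_rls[OF assms(2) feas0] by (simp add: case_prod_unfold)
  also have "\<dots> = - measure_pmf.expectation (rls \<alpha> \<beta> m xs S\<^sub>0) (\<lambda>(T, T'). q T)"
    by (simp add: case_prod_unfold)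
  finally show ?thesis by (simp add: q_def case_prod_unfold)
qed

section \<open>Several passes\<close>

lemma multi_Suc:
  "multi \<alpha> \<beta> m \<sigma> (Suc i) = multi \<alpha> \<beta> m \<sigma> i \<bind> (\<lambda>(S, S').
     map_pmf (\<lambda>(T, T'). (T, if f S' \<ge> f T' then S' else T')) (rls \<alpha> (\<beta> (Suc i)) m (\<sigma> (Suc i)) S))"
  by (simp add: map_pmf_def case_prod_unfold)

lemma multi_SucE:
  assumes "(T, T') \<in> set_pmf (multi \<alpha> \<beta> m \<sigma> (Suc i))"
  obtains S S' U where "(S, S') \<in> set_pmf (multi \<alpha> \<beta> m \<sigma> i)"
    "(T, U) \<in> set_pmf (rls \<alpha> (\<beta> (Suc i)) m (\<sigma> (Suc i)) S)" "T' = (if f S' \<ge> f U then S' else U)"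
proof -
  obtain s where s: "s \<in> set_pmf (multi \<alpha> \<beta> m \<sigma> i)" "(T, T') \<in> set_pmf (case s of (S, S') \<Rightarrow>
      map_pmf (\<lambda>(T, T'). (T, if f S' \<ge> f T' then S' else T')) (rls \<alpha> (\<beta> (Suc i)) m (\<sigma> (Suc i)) S))"
    using assms unfolding multi_Suc set_bind_pmf by blast
  obtain S S' where S: "s = (S, S')" by (cases s)
  obtain t where t: "t \<in> set_pmf (rls \<alpha> (\<beta> (Suc i)) m (\<sigma> (Suc i)) S)"
    "(T, T') = (case t of (T, T') \<Rightarrow> (T, if f S' \<ge> f T' then S' else T'))"
    using s(2) unfolding S by (auto simp del: multipass.simps)
  obtain U where "t = (T, U)" "T' = (if f S' \<ge> f U then S' else U)" using t(2) by (cases t) auto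
  then show ?thesis using that s(1) S t(1) by blast
qed

lemma empty_feasible: "feas {}"
  using good_Nil by (simp add: good_def)

lemma multi_support:
  assumes "\<forall>i. set (\<sigma> i) = X"
  shows "finite (set_pmf (multi \<alpha> \<beta> m \<sigma> i))
    \<and> (\<forall>(S, S')\<in>set_pmf (multi \<alpha> \<beta> m \<sigma> i). feas (set S) \<and> feas S')"
proof (induction i)
  case 0
  then show ?case by (simp add: empty_feasible)
next
  case (Suc i)
  have fin: "finite (set_pmf (rls \<alpha> (\<beta> (Suc i)) m (\<sigma> (Suc i)) S))" if "(S, S') \<in> set_pmf (multi \<alpha> \<beta> m \<sigma> i)" for S S'
    using Suc that by (intro rls_support(1)[OF eq_refl[OF assms[rule_format]]]) blast
  have "finite (set_pmf (multi \<alpha> \<beta> m \<sigma> (Suc i)))"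
    unfolding multi_Suc set_bind_pmf
  proof (rule finite_UN_I)
    show "finite (set_pmf (multi \<alpha> \<beta> m \<sigma> i))" using Suc by blast
    show "finite (set_pmf (case s of (S, S') \<Rightarrow> map_pmf (\<lambda>(T, T'). (T, if f S' \<ge> f T' then S' else T'))
        (rls \<alpha> (\<beta> (Suc i)) m (\<sigma> (Suc i)) S)))" if "s \<in> set_pmf (multi \<alpha> \<beta> m \<sigma> i)" for s
      using fin[of "fst s" "snd s"] that by (simp add: case_prod_unfold)
  qed
  moreover have "feas (set T) \<and> feas T'" if "(T, T') \<in> set_pmf (multi \<alpha> \<beta> m \<sigma> (Suc i))" for T T'
    using that
  proof (rule multi_SucE)
    fix S S' U
    assume a: "(S, S') \<in> set_pmf (multi \<alpha> \<beta> m \<sigma> i)"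
      "(T, U) \<in> set_pmf (rls \<alpha> (\<beta> (Suc i)) m (\<sigma> (Suc i)) S)" "T' = (if f S' \<ge> f U then S' else U)"
    then have S: "feas (set S)" "feas S'" using Suc by blast+
    then show ?thesis using rls_support(2)[OF eq_refl[OF assms[rule_format]] S(1) a(2)] a(3) by simp
  qed
  ultimately show ?case by blast
qed

lemma multi_good:
  assumes "\<forall>i. set (\<sigma> i) = X" "\<alpha> > 0" "\<And>j. 1 \<le> j \<Longrightarrow> j \<le> i \<Longrightarrow> \<beta> j > 0"
    and "(S, S') \<in> set_pmf (multi \<alpha> \<beta> m \<sigma> i)"
  shows "good S"
  using assms(3,4)
proof (induction i arbitrary: S S')
  case 0
  then show ?case by (simp add: good_Nil)
next
  case (Suc i)
  from Suc.prems(2) show ?case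
  proof (rule multi_SucE)
    fix S1 S1' U
    assume 1: "(S1, S1') \<in> set_pmf (multi \<alpha> \<beta> m \<sigma> i)"
      and 2: "(S, U) \<in> set_pmf (rls \<alpha> (\<beta> (Suc i)) m (\<sigma> (Suc i)) S1)"
    have g: "good S1" using Suc.IH[OF _ 1] Suc.prems(1) by simp
    then show ?thesis
      using rls_support(3)[OF eq_refl[OF assms(1)[rule_format]] _ g assms(2) _ 2] Suc.prems(1)[of "Suc i"]
      by (simp add: good_def)
  qed
qed

lemma expectation_multi_Suc:
  fixes h :: "'a list \<times> 'a set \<Rightarrow> real"
  assumes "\<forall>i. set (\<sigma> i) = X"
  shows "measure_pmf.expectation (multi \<alpha> \<beta> m \<sigma> (Suc i)) h =
    measure_pmf.expectation (multi \<alpha> \<beta> m \<sigma> i) (\<lambda>(S, S').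
      measure_pmf.expectation (rls \<alpha> (\<beta> (Suc i)) m (\<sigma> (Suc i)) S)
        (\<lambda>(T, T'). h (T, if f S' \<ge> f T' then S' else T')))"
  unfolding multi_Suc using multi_support[OF assms] rls_support(1)[OF eq_refl[OF assms[rule_format]]]
  by (subst expectation_bind_finite) (auto simp: case_prod_unfold)

abbreviation "value_S \<alpha> \<beta> m \<sigma> i \<equiv> measure_pmf.expectation (multi \<alpha> \<beta> m \<sigma> i) (\<lambda>(S, S'). f (set S))"
abbreviation "value_S' \<alpha> \<beta> m \<sigma> i \<equiv> measure_pmf.expectation (multi \<alpha> \<beta> m \<sigma> i) (\<lambda>(S, S'). f S')"

lemma value_S'_mono:
  assumes "\<forall>i. set (\<sigma> i) = X"
  shows "value_S' \<alpha> \<beta> m \<sigma> i \<le> value_S' \<alpha> \<beta> m \<sigma> (Suc i)"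
  unfolding expectation_multi_Suc[OF assms]
proof (rule expectation_mono_finite)
  show "finite (set_pmf (multi \<alpha> \<beta> m \<sigma> i))" using multi_support[OF assms] by blast
  fix s assume s: "s \<in> set_pmf (multi \<alpha> \<beta> m \<sigma> i)"
  obtain S S' where S: "s = (S, S')" by (cases s)
  have "finite (set_pmf (rls \<alpha> (\<beta> (Suc i)) m (\<sigma> (Suc i)) S))"
    using s S multi_support[OF assms] by (intro rls_support(1)[OF eq_refl[OF assms[rule_format]]]) blast
  then have "measure_pmf.expectation (rls \<alpha> (\<beta> (Suc i)) m (\<sigma> (Suc i)) S) (\<lambda>_. f S')
      \<le> measure_pmf.expectation (rls \<alpha> (\<beta> (Suc i)) m (\<sigma> (Suc i)) S)
        (\<lambda>(T, T'). f (if f S' \<ge> f T' then S' else T'))"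
    by (rule expectation_mono_finite) auto
  then show "(case s of (S, S') \<Rightarrow> f S') \<le> (case s of (S, S') \<Rightarrow>
      measure_pmf.expectation (rls \<alpha> (\<beta> (Suc i)) m (\<sigma> (Suc i)) S)
        (\<lambda>(T, T'). case (T, if f S' \<ge> f T' then S' else T') of (S, S') \<Rightarrow> f S'))"
    by (simp add: S)
qed

lemma value_nonneg:
  assumes "\<forall>i. set (\<sigma> i) = X"
  shows "0 \<le> value_S \<alpha> \<beta> m \<sigma> i" "0 \<le> value_S' \<alpha> \<beta> m \<sigma> i"
  using multi_support[OF assms, where \<alpha> = \<alpha> and \<beta> = \<beta> and m = m and i = i] f_nonneg feasible_subset
  by (fastforce intro!: integral_nonneg_AE simp: AE_measure_pmf_iff)+

text \<open>The quantity \<open>q\<close> of \<open>pass_occupancy\<close> is at most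
  \<open>f OPT / (\<alpha> * real m)\<close> for the empty solution and does not grow in expectation
  in any pass, so the bound is independent of the number of passes.\<close>

lemma multi_occupancy:
  assumes "\<forall>i. set (\<sigma> i) = X" "\<alpha> > 0" "m > 0" "\<And>j. 1 \<le> j \<Longrightarrow> j \<le> i \<Longrightarrow> \<beta> j > 0"
  shows "measure_pmf.expectation (multi \<alpha> \<beta> m \<sigma> i) (\<lambda>(S, S'). of_bool (e \<in> set S)) \<le> f OPT / (\<alpha> * real m)"
proof -
  define q :: "'a list \<Rightarrow> real"
    where "q S = of_bool (e \<in> set S) + (f OPT - f (set S)) / (\<alpha> * real m)" for S
  have fin: "finite (set_pmf (multi \<alpha> \<beta> m \<sigma> i))" for i using multi_support[OF assms(1)] by blast
  have "measure_pmf.expectation (multi \<alpha> \<beta> m \<sigma> i) (\<lambda>(S, S'). q S) \<le> f OPT / (\<alpha> * real m)"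
    using assms(4)
  proof (induction i)
    case 0
    then show ?case using f_nonneg[of "{}"] assms(2,3) by (simp add: q_def divide_right_mono)
  next
    case (Suc i)
    have "measure_pmf.expectation (multi \<alpha> \<beta> m \<sigma> (Suc i)) (\<lambda>(S, S'). q S)
        \<le> measure_pmf.expectation (multi \<alpha> \<beta> m \<sigma> i) (\<lambda>(S, S'). q S)"
      unfolding expectation_multi_Suc[OF assms(1)]
    proof (rule expectation_mono_finite[OF fin])
      fix s assume s: "s \<in> set_pmf (multi \<alpha> \<beta> m \<sigma> i)"
      obtain S S' where S: "s = (S, S')" by (cases s)
      have "good S" using s S multi_good[OF assms(1,2)] Suc.prems by (metis le_SucI)
      then show "(case s of (S, S') \<Rightarrow> measure_pmf.expectation (rls \<alpha> (\<beta> (Suc i)) m (\<sigma> (Suc i)) S)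
          (\<lambda>(T, T'). case (T, if f S' \<ge> f T' then S' else T') of (S, S') \<Rightarrow> q S))
          \<le> (case s of (S, S') \<Rightarrow> q S)"
        using pass_occupancy[OF _ eq_refl[OF assms(1)[rule_format]] assms(2) Suc.prems[of "Suc i"] assms(3), where S\<^sub>0 = S and e = e]
        by (simp add: S q_def)
    qed
    also have "\<dots> \<le> f OPT / (\<alpha> * real m)" using Suc by simp
    finally show ?case .
  qed
  moreover have "measure_pmf.expectation (multi \<alpha> \<beta> m \<sigma> i) (\<lambda>(S, S'). of_bool (e \<in> set S))
      \<le> measure_pmf.expectation (multi \<alpha> \<beta> m \<sigma> i) (\<lambda>(S, S'). q S)"
  proof (rule expectation_mono_finite[OF fin])
    fix s assume s: "s \<in> set_pmf (multi \<alpha> \<beta> m \<sigma> i)"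
    obtain S S' where S: "s = (S, S')" by (cases s)
    have "f (set S) \<le> f OPT" using s S multi_support[OF assms(1)] le_OPT by blast
    then show "(case s of (S, S') \<Rightarrow> of_bool (e \<in> set S)) \<le> (case s of (S, S') \<Rightarrow> q S)"
      using assms(2,3) by (simp add: S q_def)
  qed
  ultimately show ?thesis by linarith
qed

text \<open>\<open>expectation_random_set_ge\<close> for the function
  \<open>\<lambda>T. f (OPT \<union> T)\<close>. It controls the loss caused by the solution
  inherited from earlier passes.\<close>

lemma OPT_union_multi_ge:
  assumes "\<forall>i. set (\<sigma> i) = X" "\<alpha> > 0" "m > 0" "\<And>j. 1 \<le> j \<Longrightarrow> j \<le> i \<Longrightarrow> \<beta> j > 0"
  shows "(1 - f OPT / (\<alpha> * real m)) * f OPT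
    \<le> measure_pmf.expectation (multi \<alpha> \<beta> m \<sigma> i) (\<lambda>(S, S'). f (OPT \<union> set S))"
proof -
  have sub: "submodular_on X (\<lambda>T. f (OPT \<union> T))"
    unfolding submodular_on_def
  proof (intro allI impI)
    fix A B assume AB: "A \<subseteq> X" "B \<subseteq> X"
    have "f ((OPT \<union> A) \<union> (OPT \<union> B)) + f ((OPT \<union> A) \<inter> (OPT \<union> B)) \<le> f (OPT \<union> A) + f (OPT \<union> B)"
      using f_submodular[unfolded submodular_on_def, rule_format, of "OPT \<union> A" "OPT \<union> B"] AB OPT_subset by auto
    moreover have "(OPT \<union> A) \<union> (OPT \<union> B) = OPT \<union> (A \<union> B)" "(OPT \<union> A) \<inter> (OPT \<union> B) = OPT \<union> (A \<inter> B)" by auto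
    ultimately show "f (OPT \<union> (A \<union> B)) + f (OPT \<union> (A \<inter> B)) \<le> f (OPT \<union> A) + f (OPT \<union> B)" by simp
  qed
  have "(1 - f OPT / (\<alpha> * real m)) * f (OPT \<union> {})
    \<le> measure_pmf.expectation (multi \<alpha> \<beta> m \<sigma> i) (\<lambda>s. f (OPT \<union> set (fst s)))"
  proof (rule expectation_random_set_ge[OF finite_X sub])
    show "finite (set_pmf (multi \<alpha> \<beta> m \<sigma> i))" using multi_support[OF assms(1)] by blast
    show "set (fst s) \<subseteq> X" if "s \<in> set_pmf (multi \<alpha> \<beta> m \<sigma> i)" for s
    proof -
      obtain S S' where S: "s = (S, S')" by (cases s)
      have "feas (set S)" using that multi_support[OF assms(1)] unfolding S by blast
      then show ?thesis using feasible_subset S by simp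
    qed
    show "0 \<le> f OPT / (\<alpha> * real m)" using assms f_nonneg[OF OPT_subset] by simp
    show "measure_pmf.expectation (multi \<alpha> \<beta> m \<sigma> i) (\<lambda>s. of_bool (e \<in> set (fst s))) \<le> f OPT / (\<alpha> * real m)" for e
      using multi_occupancy[OF assms] by (simp add: case_prod_unfold)
    show "0 \<le> f (OPT \<union> T)" if "T \<subseteq> X" for T using that OPT_subset by (intro f_nonneg) auto
  qed
  then show ?thesis by (simp add: case_prod_unfold)
qed

text \<open>\<open>pass_value\<close> averaged over the inherited solution. The retained
  \<open>S'\<close> is at least as good as the offline solution of the new pass, and \<gamma> is
  nonnegative.\<close>

lemma multi_step:
  assumes "\<forall>i. set (\<sigma> i) = X" "\<alpha> > 0" "m > 0" "f OPT \<le> \<alpha> * real m" "\<gamma> \<ge> 0"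
    and "\<And>j. 1 \<le> j \<Longrightarrow> j \<le> Suc i \<Longrightarrow> \<beta> j > 0"
  shows "(1 - f OPT / (\<alpha> * real m)) * measure_pmf.expectation (multi \<alpha> \<beta> m \<sigma> i) (\<lambda>(S, S'). f (OPT \<union> set S))
      + (real p / \<beta> (Suc i) + real p - 1) * value_S \<alpha> \<beta> m \<sigma> i - real k * \<alpha>
    \<le> real p * (1 + \<beta> (Suc i))\<^sup>2 / \<beta> (Suc i) * value_S \<alpha> \<beta> m \<sigma> (Suc i) + \<gamma> * value_S' \<alpha> \<beta> m \<sigma> (Suc i)"
    (is "?u * ?EU + ?b * _ - ?ka \<le> ?c * _ + _")
proof -
  let ?E = "measure_pmf.expectation"
  have fin: "finite (set_pmf (multi \<alpha> \<beta> m \<sigma> i))" for i using multi_support[OF assms(1)] by blast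
  note int = integrable_measure_pmf_finite[OF fin]
  have "?u * ?EU + ?b * value_S \<alpha> \<beta> m \<sigma> i - ?ka
    = ?E (multi \<alpha> \<beta> m \<sigma> i) (\<lambda>(S, S'). ?u * f (OPT \<union> set S) + ?b * f (set S) - ?ka)"
    by (simp add: case_prod_unfold int measure_pmf.prob_space)
  also have "\<dots> \<le> ?E (multi \<alpha> \<beta> m \<sigma> (Suc i)) (\<lambda>(T, T'). ?c * f (set T) + \<gamma> * f T')"
    unfolding expectation_multi_Suc[OF assms(1)]
  proof (rule expectation_mono_finite[OF fin])
    fix s assume s: "s \<in> set_pmf (multi \<alpha> \<beta> m \<sigma> i)"
    obtain S S' where S: "s = (S, S')" by (cases s)
    have g: "good S" using s S multi_good[OF assms(1,2)] assms(6) by (metis le_SucI)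
    then have fin': "finite (set_pmf (rls \<alpha> (\<beta> (Suc i)) m (\<sigma> (Suc i)) S))"
      by (intro rls_support(1)[OF eq_refl[OF assms(1)[rule_format]]]) (simp add: good_def)
    have "?u * f (OPT \<union> set S) + ?b * f (set S) - ?ka
      \<le> ?E (rls \<alpha> (\<beta> (Suc i)) m (\<sigma> (Suc i)) S) (\<lambda>(T, T'). ?c * f (set T) + \<gamma> * f T')"
      by (rule pass_value[OF g assms(1)[rule_format] assms(2) _ assms(3,4)]) (use assms(6) in auto)
    also have "\<dots> \<le> ?E (rls \<alpha> (\<beta> (Suc i)) m (\<sigma> (Suc i)) S)
        (\<lambda>(T, T'). ?c * f (set T) + \<gamma> * f (if f S' \<ge> f T' then S' else T'))"
      using assms(5) by (intro expectation_mono_finite[OF fin']) (auto intro!: mult_left_mono)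
    finally show "(case s of (S, S') \<Rightarrow> ?u * f (OPT \<union> set S) + ?b * f (set S) - ?ka)
      \<le> (case s of (S, S') \<Rightarrow> ?E (rls \<alpha> (\<beta> (Suc i)) m (\<sigma> (Suc i)) S)
          (\<lambda>(T, T'). case (T, if f S' \<ge> f T' then S' else T') of (T, T') \<Rightarrow> ?c * f (set T) + \<gamma> * f T'))"
      by (simp add: S)
  qed
  also have "\<dots> = ?c * value_S \<alpha> \<beta> m \<sigma> (Suc i) + \<gamma> * value_S' \<alpha> \<beta> m \<sigma> (Suc i)"
    by (simp add: case_prod_unfold int del: multipass.simps)
  finally show ?thesis .
qed

section \<open>Schedules of thresholds\<close>

text \<open>\<Gamma> is the factor that results from eliminating the value of the previous solution
  between the bound for a new pass and the guarantee before it. Keeping \<Gamma> and \<beta>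
  abstract serves both threshold schedules.\<close>

lemma schedule_ratio:
  fixes \<Gamma> \<beta> :: "nat \<Rightarrow> real"
  assumes \<sigma>: "\<forall>i. set (\<sigma> i) = X" and \<epsilon>: "\<epsilon> > 0" and \<alpha>: "\<alpha> = \<epsilon> * f OPT / (2 * real k)" and pos: "f OPT > 0"
    and \<beta>: "\<And>j. 1 \<le> j \<Longrightarrow> \<beta> j > 0"
    and \<Gamma>_1: "\<Gamma> 1 = real p * (1 + \<beta> 1)\<^sup>2 / \<beta> 1"
    and \<Gamma>_Suc: "\<And>j. 1 \<le> j \<Longrightarrow> real p * (1 + \<beta> (Suc j))\<^sup>2 / \<beta> (Suc j) * \<Gamma> j
      = \<Gamma> (Suc j) * (\<Gamma> j + (real p / \<beta> (Suc j) + real p - 1))"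
    and \<Gamma>_ge: "\<And>j. 1 \<le> j \<Longrightarrow> \<Gamma> j \<ge> 1"
    and i: "1 \<le> i" "i \<le> d"
  shows "(1 - \<epsilon>) * f OPT \<le> \<Gamma> i * value_S \<alpha> \<beta> (buffer_size d k \<epsilon>) \<sigma> i
    + \<gamma> * value_S' \<alpha> \<beta> (buffer_size d k \<epsilon>) \<sigma> i"
proof -
  define m where "m = buffer_size d k \<epsilon>"
  have \<gamma>: "\<gamma> \<ge> 0" using gamma_ge_1[OF pos] by simp
  have b_nonneg: "0 \<le> real p / \<beta> j + real p - 1" if "1 \<le> j" for j
  proof -
    have "0 \<le> real p / \<beta> j" using \<beta>[OF that] by simp
    then show ?thesis using p_ge_1 by linarith
  qed
  have S_nonneg: "0 \<le> value_S \<alpha> \<beta> m \<sigma> j" "0 \<le> value_S' \<alpha> \<beta> m \<sigma> j" for j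
    using value_nonneg[OF \<sigma>] by auto
  consider "\<epsilon> \<ge> 1" | "k = 0" "\<epsilon> < 1" | "k > 0" "\<epsilon> < 1" by linarith
  then have "(1 - \<epsilon>) * f OPT \<le> \<Gamma> i * value_S \<alpha> \<beta> m \<sigma> i + \<gamma> * value_S' \<alpha> \<beta> m \<sigma> i"
  proof cases
    case 1
    then have "(1 - \<epsilon>) * f OPT \<le> 0" using pos by (simp add: mult_nonpos_nonneg)
    also have "0 \<le> \<Gamma> i * value_S \<alpha> \<beta> m \<sigma> i + \<gamma> * value_S' \<alpha> \<beta> m \<sigma> i"
      using \<Gamma>_ge[OF i(1)] \<gamma> S_nonneg by (intro add_nonneg_nonneg mult_nonneg_nonneg) auto
    finally show ?thesis .
  next
    case 2
    \<comment> \<open>Rank 0 is treated apart, because \<alpha> is then 0 by the convention for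
      division by zero; every feasible set is empty.\<close>
    have empty: "T = {}" if "feas T" for T
      using card_feasible_le[OF that] 2 feasible_subset[OF that] finite_X finite_subset by fastforce
    have "value_S \<alpha> \<beta> m \<sigma> i = measure_pmf.expectation (multi \<alpha> \<beta> m \<sigma> i) (\<lambda>_. f OPT)"
      using multi_support[OF \<sigma>, of \<alpha> \<beta> m i] empty empty[OF OPT_feasible]
      by (intro integral_cong_AE) (fastforce simp: AE_measure_pmf_iff)+
    then have "value_S \<alpha> \<beta> m \<sigma> i = f OPT" by simp
    moreover have "(1 - \<epsilon>) * f OPT \<le> \<Gamma> i * f OPT"
      using \<Gamma>_ge[OF i(1)] \<epsilon> pos by (intro mult_right_mono) auto
    moreover have "0 \<le> \<gamma> * value_S' \<alpha> \<beta> m \<sigma> i" using \<gamma> S_nonneg by (intro mult_nonneg_nonneg)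
    ultimately show ?thesis by (simp only: add_increasing2)
  next
    case 3
    have d: "real d \<ge> 1" using i by linarith
    have \<alpha>_pos: "\<alpha> > 0" using \<alpha> \<epsilon> pos 3 by simp
    have k\<alpha>: "real k * \<alpha> = \<epsilon> / 2 * f OPT" using \<alpha> 3 by simp
    have m_ge: "4 * real d * real k / \<epsilon>\<^sup>2 \<le> real m" unfolding m_def buffer_size_def by linarith
    have "4 * real d * real k / \<epsilon>\<^sup>2 > 0" using d 3 \<epsilon> by simp
    then have m_pos: "m > 0" using m_ge by (metis less_le_trans of_nat_0_less_iff)
    define q where "q = f OPT / (\<alpha> * real m)"
    \<comment> \<open>The buffer size enters here: it makes \<open>q\<close> at most
      \<open>\<epsilon> / (2 * d)\<close>.\<close>
    have "2 * real d * f OPT = \<epsilon> * (\<alpha> * (4 * real d * real k / \<epsilon>\<^sup>2))"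
      using \<alpha> 3 \<epsilon> by (simp add: field_simps power2_eq_square)
    also have "\<dots> \<le> \<epsilon> * (\<alpha> * real m)" using m_ge \<epsilon> \<alpha>_pos by (intro mult_left_mono) auto
    finally have q_le: "2 * real d * q \<le> \<epsilon>"
      using \<alpha>_pos m_pos by (simp add: q_def field_simps)
    have q0: "0 \<le> q" using pos \<alpha>_pos by (simp add: q_def)
    have "2 * q \<le> 2 * real d * q" using d q0 by (simp add: mult_right_mono)
    then have q_half: "q \<le> \<epsilon> / 2" using q_le by linarith
    then have "q \<le> 1" using 3 by linarith
    then have fm: "f OPT \<le> \<alpha> * real m" using \<alpha>_pos m_pos by (simp add: q_def)
    show ?thesis
      using i
    proof (induction i rule: nat_induct_at_least)
      case base
      \<comment> \<open>The first pass starts from the empty solution, so only one factor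
        \<open>1 - q\<close> appears; its loss and \<open>k * \<alpha>\<close> each cost at most
        half of \<epsilon>.\<close>
      have "(1 - \<epsilon>) * f OPT \<le> (1 - q) * f OPT - real k * \<alpha>"
        using mult_right_mono[OF q_half, of "f OPT"] pos unfolding k\<alpha> by (simp add: algebra_simps)
      moreover have "0 \<le> (real p / \<beta> 1 + real p - 1) * f {}"
        using b_nonneg[of 1] f_nonneg[of "{}"] by (intro mult_nonneg_nonneg) auto
      ultimately show ?case
        using multi_step[OF \<sigma> \<alpha>_pos m_pos fm \<gamma>, of 0 \<beta>] \<beta> by (simp add: \<Gamma>_1[unfolded One_nat_def] q_def del: multipass.simps(2))
    next
      case (Suc n)
      let ?b = "real p / \<beta> (Suc n) + real p - 1" and ?c = "real p * (1 + \<beta> (Suc n))\<^sup>2 / \<beta> (Suc n)"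
      define Q where "Q = (1 - \<epsilon>) * f OPT - \<gamma> * value_S' \<alpha> \<beta> m \<sigma> (Suc n)"
      have n: "1 \<le> n" "n \<le> d" using Suc by auto
      have b0: "0 \<le> ?b" using b_nonneg[of "Suc n"] by simp
      have g0: "\<Gamma> n > 0" using \<Gamma>_ge[OF n(1)] by linarith
      \<comment> \<open>A later pass has two factors \<open>1 - q\<close>, one for the inherited
        solution and one for the pass itself; with \<open>d \<ge> 2\<close> each loses at most
        \<open>\<epsilon> / 4\<close>.\<close>
      have "real d \<ge> 2" using Suc.prems n by linarith
      then have "4 * q \<le> 2 * real d * q" using q0 by (intro mult_right_mono) auto
      then have q4: "q \<le> \<epsilon> / 4" using q_le by linarith
      have "(1 - q) * ((1 - q) * f OPT)
        \<le> (1 - q) * measure_pmf.expectation (multi \<alpha> \<beta> m \<sigma> n) (\<lambda>(S, S'). f (OPT \<union> set S))"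
        using OPT_union_multi_ge[OF \<sigma> \<alpha>_pos m_pos, of n \<beta>] \<beta> \<open>q \<le> 1\<close>
        unfolding q_def by (intro mult_left_mono) auto
      moreover have "(1 - \<epsilon> / 2) * f OPT \<le> (1 - q) * ((1 - q) * f OPT)"
      proof -
        have "1 - \<epsilon> / 2 \<le> (1 - q) * (1 - q)"
        proof -
          have "(1 - q) * (1 - q) = 1 - 2 * q + q * q" by (simp add: algebra_simps)
          then show ?thesis using q4 zero_le_square[of q] by linarith
        qed
        from mult_right_mono[OF this, of "f OPT"] show ?thesis using pos by (simp add: mult.assoc)
      qed
      moreover have "(1 - \<epsilon>) * f OPT = (1 - \<epsilon> / 2) * f OPT - real k * \<alpha>"
        unfolding k\<alpha> by (simp add: algebra_simps)
      moreover have "(1 - q) * measure_pmf.expectation (multi \<alpha> \<beta> m \<sigma> n) (\<lambda>(S, S'). f (OPT \<union> set S))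
          + ?b * value_S \<alpha> \<beta> m \<sigma> n - real k * \<alpha>
        \<le> ?c * value_S \<alpha> \<beta> m \<sigma> (Suc n) + \<gamma> * value_S' \<alpha> \<beta> m \<sigma> (Suc n)"
        unfolding q_def by (rule multi_step[OF \<sigma> \<alpha>_pos m_pos fm \<gamma>]) (rule \<beta>)
      ultimately have one: "Q \<le> ?c * value_S \<alpha> \<beta> m \<sigma> (Suc n) - ?b * value_S \<alpha> \<beta> m \<sigma> n"
        unfolding Q_def by linarith
      have "\<gamma> * value_S' \<alpha> \<beta> m \<sigma> n \<le> \<gamma> * value_S' \<alpha> \<beta> m \<sigma> (Suc n)"
        by (intro mult_left_mono value_S'_mono \<sigma> \<gamma>)
      then have two: "Q \<le> \<Gamma> n * value_S \<alpha> \<beta> m \<sigma> n" using Suc.IH n unfolding Q_def by linarith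
      \<comment> \<open>The bounds \<open>one\<close> and \<open>two\<close> get the weights
        \<open>\<Gamma> n\<close> and \<open>?b\<close>, so that the value of the solution after
        pass \<open>n\<close> cancels.\<close>
      have "(\<Gamma> n + ?b) * Q = \<Gamma> n * Q + ?b * Q" by (simp only: distrib_right)
      also have "\<dots> \<le> \<Gamma> n * (?c * value_S \<alpha> \<beta> m \<sigma> (Suc n) - ?b * value_S \<alpha> \<beta> m \<sigma> n)
          + ?b * (\<Gamma> n * value_S \<alpha> \<beta> m \<sigma> n)"
        using one two b0 g0 by (intro add_mono mult_left_mono) auto
      also have "\<dots> = (?c * \<Gamma> n) * value_S \<alpha> \<beta> m \<sigma> (Suc n)"
        by (simp only: right_diff_distrib mult_ac)
      also have "\<dots> = (\<Gamma> n + ?b) * (\<Gamma> (Suc n) * value_S \<alpha> \<beta> m \<sigma> (Suc n))"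
        unfolding \<Gamma>_Suc[OF n(1)] by (simp only: mult_ac)
      finally have "Q \<le> \<Gamma> (Suc n) * value_S \<alpha> \<beta> m \<sigma> (Suc n)"
        by (rule mult_left_le_imp_le) (use b0 g0 in linarith)
      then show ?case unfolding Q_def by linarith
    qed
  qed
  then show ?thesis by (simp only: m_def)
qed

section \<open>From the two maintained solutions to the returned one\<close>

lemma multipass_output_ge:
  assumes "\<forall>i. set (\<sigma> i) = X"
  shows "value_S \<alpha> \<beta> m \<sigma> i
      \<le> measure_pmf.expectation (multipass_output f X L E \<I> tie offline \<alpha> \<beta> m \<sigma> i) f"
    and "value_S' \<alpha> \<beta> m \<sigma> i
      \<le> measure_pmf.expectation (multipass_output f X L E \<I> tie offline \<alpha> \<beta> m \<sigma> i) f"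
  unfolding multipass_output_def integral_map_pmf
  using multi_support[OF assms] by (auto intro!: expectation_mono_finite)

lemma output_ratio:
  assumes "\<forall>i. set (\<sigma> i) = X" "f OPT > 0" "0 \<le> c" "c \<le> c'"
    and "v \<le> c * value_S \<alpha> \<beta> m \<sigma> i + \<gamma> * value_S' \<alpha> \<beta> m \<sigma> i"
  shows "v \<le> (c' + \<gamma>)
    * measure_pmf.expectation (multipass_output f X L E \<I> tie offline \<alpha> \<beta> m \<sigma> i) f"
proof -
  let ?o = "measure_pmf.expectation (multipass_output f X L E \<I> tie offline \<alpha> \<beta> m \<sigma> i) f"
  have o0: "0 \<le> ?o" using multipass_output_ge(1)[OF assms(1)] value_nonneg(1)[OF assms(1)] order_trans by blast
  have "c * value_S \<alpha> \<beta> m \<sigma> i \<le> c * ?o" using assms by (intro mult_left_mono multipass_output_ge)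
  moreover have "\<gamma> * value_S' \<alpha> \<beta> m \<sigma> i \<le> \<gamma> * ?o"
    using assms gamma_ge_1 by (intro mult_left_mono multipass_output_ge) auto
  moreover have "c * ?o \<le> c' * ?o" using assms(4) o0 by (rule mult_right_mono)
  ultimately show ?thesis using assms(5) by (simp only: distrib_right)
qed

text \<open>Treated apart, since the offline guarantee gives no lower bound on \<gamma> when all
  feasible sets have value 0.\<close>

lemma OPT_zero:
  assumes "\<forall>i. set (\<sigma> i) = X" "f OPT = 0"
  shows "value_S \<alpha> \<beta> m \<sigma> i = 0" "value_S' \<alpha> \<beta> m \<sigma> i = 0"
    and "measure_pmf.expectation (multipass_output f X L E \<I> tie offline \<alpha> \<beta> m \<sigma> i) f = 0"
proof -
  have 0: "f T = 0" if "feas T" for T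
    using le_OPT[OF that] assms(2) f_nonneg[OF feasible_subset[OF that]] by simp
  have supp: "f (set S) = 0 \<and> f S' = 0" if "(S, S') \<in> set_pmf (multi \<alpha> \<beta> m \<sigma> i)" for S S'
    using 0 that multi_support[OF assms(1)] by blast
  have zero: "measure_pmf.expectation (multi \<alpha> \<beta> m \<sigma> i) h = 0"
    if "\<And>S S'. f (set S) = 0 \<Longrightarrow> f S' = 0 \<Longrightarrow> h (S, S') = 0" for h :: "'a list \<times> 'a set \<Rightarrow> real"
  proof -
    have "measure_pmf.expectation (multi \<alpha> \<beta> m \<sigma> i) h = measure_pmf.expectation (multi \<alpha> \<beta> m \<sigma> i) (\<lambda>_. 0)"
      using that supp by (intro integral_cong_AE) (auto simp: AE_measure_pmf_iff)
    then show ?thesis by simp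
  qed
  show "value_S \<alpha> \<beta> m \<sigma> i = 0" "value_S' \<alpha> \<beta> m \<sigma> i = 0" by (rule zero; simp)+
  show "measure_pmf.expectation (multipass_output f X L E \<I> tie offline \<alpha> \<beta> m \<sigma> i) f = 0"
    unfolding multipass_output_def integral_map_pmf by (rule zero) simp
qed

end

section \<open>Analysis of the recurrence for the factors\<close>

text \<open>With \<open>\<delta> = \<gamma>\<^sub>i - 1 - p\<close>, one step of the recurrence increases \<open>1 / \<delta>\<close> by at least \<open>1 / (4 p)\<close>.\<close>

lemma gamma_seq_bounds:
  assumes "p \<ge> 1" "i \<ge> 1"
  shows "real p + 1 < gamma_seq p i \<and> gamma_seq p i \<le> real p + 1 + 4 * real p / real i"
  using assms(2)
proof (induction i rule: nat_induct_at_least)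
  case base
  then show ?case using assms(1) by simp
next
  case (Suc n)
  define P where "P = real p"
  define \<delta> where "\<delta> = gamma_seq p n - 1 - P"
  have P: "P \<ge> 1" using assms(1) by (simp add: P_def)
  have \<delta>: "\<delta> > 0" "\<delta> * real n \<le> 4 * P"
    using Suc by (auto simp: \<delta>_def P_def field_simps)
  obtain n' where n': "n = Suc n'" using Suc.hyps by (cases n) auto
  have g: "gamma_seq p n = 1 + P + \<delta>" by (simp add: \<delta>_def)
  have "gamma_seq p (Suc n) = 4 * P * (1 + P + \<delta>) * (P + \<delta>) / (2 * P + \<delta>)\<^sup>2"
    unfolding n' gamma_seq.simps Let_def g[unfolded n'] by (simp add: P_def[symmetric] algebra_simps)
  moreover have D: "2 * P + \<delta> > 0" using P \<delta> by linarith
  ultimately have "gamma_seq p (Suc n) - (P + 1)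
      = (4 * P * (1 + P + \<delta>) * (P + \<delta>) - (P + 1) * (2 * P + \<delta>)\<^sup>2) / (2 * P + \<delta>)\<^sup>2"
    by (simp add: diff_divide_distrib)
  \<comment> \<open>The numerator is divisible by \<delta>, so the next excess over
    \<open>P + 1\<close> is \<delta> times a positive factor.\<close>
  also have "4 * P * (1 + P + \<delta>) * (P + \<delta>) - (P + 1) * (2 * P + \<delta>)\<^sup>2
      = \<delta> * (4 * P\<^sup>2 + (3 * P - 1) * \<delta>)"
    by (simp add: algebra_simps power2_eq_square)
  finally have eq: "gamma_seq p (Suc n) - (P + 1) = \<delta> * (4 * P\<^sup>2 + (3 * P - 1) * \<delta>) / (2 * P + \<delta>)\<^sup>2" .
  have num: "4 * P\<^sup>2 + (3 * P - 1) * \<delta> > 0" using P \<delta> by (intro add_pos_pos mult_pos_pos) auto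
  \<comment> \<open>The bound \<open>4 * P / real (Suc n)\<close> for the next excess, with
    denominators cleared; one product \<open>\<delta> * real n\<close> is replaced by
    \<open>4 * P\<close>.\<close>
  have "\<delta> * (4 * P\<^sup>2 + (3 * P - 1) * \<delta>) * real (Suc n) \<le> 4 * P * (2 * P + \<delta>)\<^sup>2"
  proof -
    have "\<delta> * (4 * P\<^sup>2 + (3 * P - 1) * \<delta>) * real (Suc n)
        = (4 * P\<^sup>2 + (3 * P - 1) * \<delta>) * (\<delta> * real n) + (4 * P\<^sup>2 + (3 * P - 1) * \<delta>) * \<delta>"
      by (simp add: algebra_simps)
    also have "\<dots> \<le> (4 * P\<^sup>2 + (3 * P - 1) * \<delta>) * (4 * P) + (4 * P\<^sup>2 + (3 * P - 1) * \<delta>) * \<delta>"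
      using \<delta> num by (intro add_mono mult_left_mono) auto
    also have "\<dots> \<le> 4 * P * (2 * P + \<delta>)\<^sup>2"
    proof -
      have "4 * P * (2 * P + \<delta>)\<^sup>2 - ((4 * P\<^sup>2 + (3 * P - 1) * \<delta>) * (4 * P) + (4 * P\<^sup>2 + (3 * P - 1) * \<delta>) * \<delta>)
          = 4 * P * \<delta> + (P + 1) * \<delta>\<^sup>2"
        by (simp add: algebra_simps power2_eq_square)
      moreover have "0 \<le> 4 * P * \<delta> + (P + 1) * \<delta>\<^sup>2" using P \<delta> by simp
      ultimately show ?thesis by linarith
    qed
    finally show ?thesis .
  qed
  moreover have "a / b \<le> c / d" if "a * d \<le> c * b" "b > 0" "d > 0" for a b c d :: real
    using that by (simp add: field_simps)
  ultimately have "\<delta> * (4 * P\<^sup>2 + (3 * P - 1) * \<delta>) / (2 * P + \<delta>)\<^sup>2 \<le> 4 * P / real (Suc n)"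
    using D by (metis of_nat_0_less_iff zero_less_Suc zero_less_power)
  moreover have "0 < \<delta> * (4 * P\<^sup>2 + (3 * P - 1) * \<delta>) / (2 * P + \<delta>)\<^sup>2" using num \<delta> D by simp
  ultimately show ?case using eq by (simp add: P_def)
qed

lemma beta_seq_pos:
  assumes "p \<ge> 1"
  shows "beta_seq p j > 0"
proof (cases "j \<le> 1")
  case False
  then have "real p + 1 < gamma_seq p (j - 1)" using gamma_seq_bounds[OF assms, of "j - 1"] by simp
  then show ?thesis using False by (simp add: beta_seq_def)
qed (simp add: beta_seq_def)

text \<open>For the previous factor \<open>g\<close>, eliminating the old solution gives the factor
  \<open>p (1 + \<beta>)^2 g / (\<beta> (g + p - 1) + p)\<close>. The value in
  \<open>beta_seq\<close> minimizes it over \<beta> > 0, and the minimum is the recurrence of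
  \<open>gamma_seq\<close>.\<close>

lemma gamma_seq_Suc:
  assumes "p \<ge> 1" "j \<ge> 1"
  shows "real p * (1 + beta_seq p (Suc j))\<^sup>2 / beta_seq p (Suc j) * gamma_seq p j
    = gamma_seq p (Suc j) * (gamma_seq p j + (real p / beta_seq p (Suc j) + real p - 1))"
proof -
  define P where "P = real p"
  define \<delta> where "\<delta> = gamma_seq p j - 1 - P"
  have P: "P \<ge> 1" using assms(1) by (simp add: P_def)
  have \<delta>: "\<delta> > 0" using gamma_seq_bounds[OF assms] by (simp add: \<delta>_def P_def)
  obtain j' where j': "j = Suc j'" using assms(2) by (cases j) auto
  have g: "gamma_seq p j = 1 + P + \<delta>" by (simp add: \<delta>_def)
  have g': "gamma_seq p (Suc j) = 4 * P * (1 + P + \<delta>) * (P + \<delta>) / (2 * P + \<delta>)\<^sup>2"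
    unfolding j' gamma_seq.simps Let_def g[unfolded j'] by (simp add: P_def[symmetric] algebra_simps)
  have b: "beta_seq p (Suc j) = \<delta> / (2 * P + \<delta>)"
    using assms(2) by (simp add: beta_seq_def g P_def[symmetric] algebra_simps)
  have D: "2 * P + \<delta> > 0" using P \<delta> by linarith
  have 1: "1 + \<delta> / (2 * P + \<delta>) = 2 * (P + \<delta>) / (2 * P + \<delta>)" using D by (simp add: field_simps)
  \<comment> \<open>\<open>N\<close> stands for \<open>2 * P + \<delta>\<close>, so that
    simplification treats this denominator as a single factor.\<close>
  have "P * (2 * (P + \<delta>) / N)\<^sup>2 / (\<delta> / N) = 4 * P * (P + \<delta>)\<^sup>2 / (\<delta> * N)" if "N > 0" for N
    using that \<delta> by (simp add: field_simps power2_eq_square)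
  then have l: "P * (2 * (P + \<delta>) / (2 * P + \<delta>))\<^sup>2 / (\<delta> / (2 * P + \<delta>))
      = 4 * P * (P + \<delta>)\<^sup>2 / (\<delta> * (2 * P + \<delta>))" using D by blast
  have r: "1 + P + \<delta> + (P / (\<delta> / (2 * P + \<delta>)) + P - 1) = (P + \<delta>) * (2 * P + \<delta>) / \<delta>"
    using D \<delta> by (simp add: field_simps)
  have "4 * P * (P + \<delta>)\<^sup>2 / (\<delta> * N) * c = 4 * P * c * (P + \<delta>) / N\<^sup>2 * ((P + \<delta>) * N / \<delta>)"
    if "N > 0" for N c
    using that \<delta> by (simp add: field_simps power2_eq_square)
  then show ?thesis unfolding P_def[symmetric] g g' b 1 l r using D by blast
qed

section \<open>Both threshold schedules and the final guarantees\<close>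

theorem theorem6:
  fixes f :: "'a set \<Rightarrow> real"
    and X :: "'a set" and L :: "'i set" and E :: "'i \<Rightarrow> 'a set" and \<I> :: "'i \<Rightarrow> 'a set set"
    and p k :: nat and OPT :: "'a set" and \<epsilon> \<alpha> \<gamma>\<^sub>o\<^sub>f\<^sub>f :: real
    and tie :: "'i \<Rightarrow> 'a \<Rightarrow> 'a list \<Rightarrow> 'a set \<Rightarrow> 'a"
    and offline :: "'a set \<Rightarrow> 'a set pmf"
    and \<sigma> :: "nat \<Rightarrow> 'a list"
  assumes "p \<ge> 1" and "matchoid p X L E \<I>"
    and "\<forall>A. A \<subseteq> X \<longrightarrow> f A \<ge> 0" and "submodular_on X f"
    and "is_opt f X L E \<I> OPT"
    and "k = matchoid_rank X L E \<I>"
    and "tie_rule tie"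
    and "offline_approx f X L E \<I> offline \<gamma>\<^sub>o\<^sub>f\<^sub>f"
    and "\<forall>i. distinct (\<sigma> i) \<and> set (\<sigma> i) = X"
    and "\<epsilon> > 0"
    and "\<alpha> = \<epsilon> * f OPT / (2 * real k)"
  shows
    "(\<forall>d. \<forall>i\<in>{1..d}.
        let P = multipass f X L E \<I> tie offline \<alpha> (beta_seq p) (buffer_size d k \<epsilon>) \<sigma> i
        in (1 - \<epsilon>) * f OPT
             \<le> (real p + 1 + 4 * real p / real i) * measure_pmf.expectation P (\<lambda>(S, S'). f (set S))
               + \<gamma>\<^sub>o\<^sub>f\<^sub>f * measure_pmf.expectation P (\<lambda>(S, S'). f S')) \<and>
     (let d = nat \<lceil>4 * real p / \<epsilon>\<rceil>
      in (1 - \<epsilon>) * f OPT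
           \<le> (real p + 1 + \<gamma>\<^sub>o\<^sub>f\<^sub>f + \<epsilon>) *
             measure_pmf.expectation
               (multipass_output f X L E \<I> tie offline \<alpha> (beta_seq p) (buffer_size d k \<epsilon>) \<sigma> d) f) \<and>
     ((\<exists>l. L = {l}) \<longrightarrow>
       (let d = nat \<lceil>2 / \<epsilon>\<rceil>
        in (1 - \<epsilon>) * f OPT
             \<le> (2 + \<gamma>\<^sub>o\<^sub>f\<^sub>f + \<epsilon>) *
               measure_pmf.expectation
                 (multipass_output f X L E \<I> tie offline \<alpha> (\<lambda>i. 1 / real i) (buffer_size d k \<epsilon>) \<sigma> d) f))"
proof -
  interpret streaming_instance f X L E \<I> p tie OPT offline "\<gamma>\<^sub>o\<^sub>f\<^sub>f" k
    using assms by unfold_locales auto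
  have \<sigma>: "\<forall>i. set (\<sigma> i) = X" using assms(9) by blast
  have "0 \<le> f OPT" by (rule f_nonneg[OF OPT_subset])
  then consider (zero) "f OPT = 0" | (pos) "f OPT > 0" by linarith
  then show ?thesis
  proof cases
    case zero
    show ?thesis unfolding Let_def OPT_zero[OF \<sigma> zero] by (simp add: zero)
  next
    case pos
    have passes: "(1 - \<epsilon>) * f OPT
        \<le> (real p + 1 + 4 * real p / real i) * value_S \<alpha> (beta_seq p) (buffer_size d k \<epsilon>) \<sigma> i
          + \<gamma>\<^sub>o\<^sub>f\<^sub>f * value_S' \<alpha> (beta_seq p) (buffer_size d k \<epsilon>) \<sigma> i" if i: "1 \<le> i" "i \<le> d" for i d
    proof -
      have "(1 - \<epsilon>) * f OPT \<le> gamma_seq p i * value_S \<alpha> (beta_seq p) (buffer_size d k \<epsilon>) \<sigma> i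
          + \<gamma>\<^sub>o\<^sub>f\<^sub>f * value_S' \<alpha> (beta_seq p) (buffer_size d k \<epsilon>) \<sigma> i"
      proof (rule schedule_ratio[OF \<sigma> assms(10,11) pos, where \<Gamma> = "gamma_seq p"])
        show "gamma_seq p 1 = real p * (1 + beta_seq p 1)\<^sup>2 / beta_seq p 1"
          by (simp add: beta_seq_def)
        show "gamma_seq p j \<ge> 1" if "1 \<le> j" for j
          using gamma_seq_bounds[OF assms(1) that] by linarith
      qed (use i in \<open>simp_all only: beta_seq_pos[OF assms(1)] gamma_seq_Suc[OF assms(1)]\<close>)
      also have "\<dots> \<le> (real p + 1 + 4 * real p / real i) * value_S \<alpha> (beta_seq p) (buffer_size d k \<epsilon>) \<sigma> i
          + \<gamma>\<^sub>o\<^sub>f\<^sub>f * value_S' \<alpha> (beta_seq p) (buffer_size d k \<epsilon>) \<sigma> i"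
        using gamma_seq_bounds[OF assms(1) i(1)] value_nonneg(1)[OF \<sigma>]
        by (intro add_right_mono mult_right_mono) auto
      finally show ?thesis .
    qed
    have final_output: "(1 - \<epsilon>) * f OPT \<le> (real p + 1 + \<gamma>\<^sub>o\<^sub>f\<^sub>f + \<epsilon>) * measure_pmf.expectation
        (multipass_output f X L E \<I> tie offline \<alpha> (beta_seq p) (buffer_size d k \<epsilon>) \<sigma> d) f"
      if d: "d = nat \<lceil>4 * real p / \<epsilon>\<rceil>" for d
    proof -
      \<comment> \<open>Rounding up leaves at least one pass and makes
        \<open>4 * real p / real d\<close> at most \<epsilon>.\<close>
      have "4 * real p / \<epsilon> > 0" using assms(1,10) by simp
      then have d_ge: "4 * real p / \<epsilon> \<le> real d" "1 \<le> d" unfolding d by linarith+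
      then have "4 * real p / real d \<le> \<epsilon>" using assms(10) by (simp add: field_simps)
      then have "(1 - \<epsilon>) * f OPT \<le> (real p + 1 + \<epsilon> + \<gamma>\<^sub>o\<^sub>f\<^sub>f) * measure_pmf.expectation
          (multipass_output f X L E \<I> tie offline \<alpha> (beta_seq p) (buffer_size d k \<epsilon>) \<sigma> d) f"
        by (intro output_ratio[OF \<sigma> pos _ _ passes[OF d_ge(2) order_refl]]) auto
      then show ?thesis by (simp only: add_ac)
    qed
    have single: "(1 - \<epsilon>) * f OPT \<le> (2 + \<gamma>\<^sub>o\<^sub>f\<^sub>f + \<epsilon>) * measure_pmf.expectation
        (multipass_output f X L E \<I> tie offline \<alpha> (\<lambda>i. 1 / real i) (buffer_size d k \<epsilon>) \<sigma> d) f"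
      if L: "L = {l}" and d: "d = nat \<lceil>2 / \<epsilon>\<rceil>" for l d
    proof -
      \<comment> \<open>The given \<open>p\<close> may exceed 1 even for one matroid, so the
        instance is interpreted anew with degree 1.\<close>
      have "card {l \<in> L. x \<in> E l} \<le> 1" for x
        using card_mono[of L "{l \<in> L. x \<in> E l}"] L by auto
      then have "matchoid 1 X L E \<I>" using assms(2) by (auto simp: matchoid_def)
      then interpret M: streaming_instance f X L E \<I> 1 tie OPT offline "\<gamma>\<^sub>o\<^sub>f\<^sub>f" k
        using assms by unfold_locales auto
      have "2 / \<epsilon> > 0" using assms(10) by simp
      then have d_ge: "2 / \<epsilon> \<le> real d" "1 \<le> d" unfolding d by linarith+
      have "(1 - \<epsilon>) * f OPT \<le> (2 + 2 / real d) * value_S \<alpha> (\<lambda>i. 1 / real i) (buffer_size d k \<epsilon>) \<sigma> d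
          + \<gamma>\<^sub>o\<^sub>f\<^sub>f * value_S' \<alpha> (\<lambda>i. 1 / real i) (buffer_size d k \<epsilon>) \<sigma> d"
      proof (rule M.schedule_ratio[OF \<sigma> assms(10,11) pos, where \<Gamma> = "\<lambda>i. 2 + 2 / real i"])
        \<comment> \<open>For degree 1 and thresholds \<open>1 / i\<close> the recurrence is solved
          exactly by \<open>2 + 2 / i\<close>.\<close>
        show "real 1 * (1 + 1 / real (Suc j))\<^sup>2 / (1 / real (Suc j)) * (2 + 2 / real j)
          = (2 + 2 / real (Suc j)) * (2 + 2 / real j + (real 1 / (1 / real (Suc j)) + real 1 - 1))"
          if "1 \<le> j" for j
        proof -
          have 1: "2 + 2 / real j = 2 * real (Suc j) / real j"
            and 2: "2 * real (Suc j) / real j + real (Suc j) = real (Suc j) * (real (Suc j) + 1) / real j"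
            using that by (simp_all add: field_simps)
          have "(1 + 1 / N)\<^sup>2 / (1 / N) * (2 * N / J) = (2 + 2 / N) * (N * (N + 1) / J)"
            if "N > 0" "J > 0" for N J :: real
            using that by (simp add: field_simps power2_eq_square)
          from this[of "real (Suc j)" "real j"] that
          have "(1 + 1 / real (Suc j))\<^sup>2 / (1 / real (Suc j)) * (2 + 2 / real j)
            = (2 + 2 / real (Suc j)) * (2 + 2 / real j + real (Suc j))"
            unfolding 1 2 by simp
          then show ?thesis by simp
        qed
      qed (use d_ge in auto)
      moreover have "2 / real d \<le> \<epsilon>" using d_ge assms(10) by (simp add: field_simps)
      ultimately have "(1 - \<epsilon>) * f OPT \<le> (2 + \<epsilon> + \<gamma>\<^sub>o\<^sub>f\<^sub>f) * measure_pmf.expectation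
          (multipass_output f X L E \<I> tie offline \<alpha> (\<lambda>i. 1 / real i) (buffer_size d k \<epsilon>) \<sigma> d) f"
        by (intro output_ratio[OF \<sigma> pos, where c = "2 + 2 / real d"]) auto
      then show ?thesis by (simp only: add_ac)
    qed
    show ?thesis unfolding Let_def using passes final_output single by auto
  qed
qed

end
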